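(* Consider the two-stage problem $\inf_{x\in\mathcal X}f_0(x)+\mathbb E[f(\xi,x)]$ with $$f(\xi,x)=\inf_y\{g(\xi,y): W_\xi y+T_\xi x=h_\xi,\ y\ge 0\}.$$ Suppose $\mathcal X\subseteq\{x\in\mathbb R^n:\|x\|_0\le n_0\}$, where $n_0\le n$ is a nonnegative integer, and $|J|<+\infty$, where $$|J|=\max_{\xi\in\Xi}\{\text{number of extreme rays of the cone }\{a:a^TW_\xi\ge0\}\}.$$ Let $\xi^{[N]}=(\xi_1,\dots,\xi_N)$ be IID samples from $\mathbb P$ (so $\xi^{[N]}\sim\mathbb P^N$), and let $x^\star(\xi^{[N]})$ be the output of any algorithm that is guaranteed to be within the feasible region of SAA. Set $$d_{VC}=\frac{e}{(e-1)\log2}\,|J|\,\Big(2(n_0+1)\log_2\Big(\frac{ne+e}{n_0+1}\Big)\Big)\log\Big(\frac{e}{\log2}\cdot|J|\Big).$$ Then, for any $0<\delta,\epsilon<1$, if $$N\ge\frac4\epsilon\Big(d_{VC}\log\big(\tfrac{12}{\epsilon}\big)+\log\big(\tfrac2\delta\big)\Big),$$ we have $\mathbb P^N\big(V(x^\star(\xi^{[N]}))>\epsilon\big)\le\delta$. Equivalently, in terms of convergence rate, $$\mathbb P^N\big(V(x^\star(\xi^{[N]}))>\epsilon\big)\le 2\exp\Big(-\frac{N\epsilon}{4}\Big)\Big(\frac{12}{\epsilon}\Big)^{d_{VC}}.$$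
   Context: Setting. $(\Omega,\mathcal F,\mathbb P)$ is a complete probability space and $\xi:\Omega\to\Xi\subseteq\mathbb R^r$ a random vector ($\mathbb P$ also denotes its law). $\mathcal X\subseteq\mathbb R^n$ is nonempty and closed; $\|x\|_0$ is the number of non-zero entries of $x$. $f_0$ is a deterministic real-valued function of $x$. $W_\xi,T_\xi$ are matrices and $h_\xi$ a vector, of compatible sizes, depending on $\xi$. The function $g(\xi,\cdot)$ is convex and finite everywhere, for almost every $\xi\in\Xi$. The infimum over an empty set is $+\infty$. It is assumed that $f$ takes values in $\mathbb R\cup\{+\infty\}$, that $f(\xi,\cdot)$ is lower semicontinuous on $\mathcal X$, that $(\omega,x)\mapsto f(\xi(\omega),x)$ is measurable for the completion of $\mathcal F\otimes\mathscr B$ ($\mathscr B$ the Borel $\sigma$-algebra of $\mathcal X$), that the set of $x\in\mathcal X$ with finite objective $F(x)=f_0(x)+\mathbb E[f(\xi,x)]<+\infty$ is non-empty, and that all quantities of interest are measurable. The rows of each matrix $W_\xi$ are assumed linearly independent, so that each cone $\{a:a^TW_\xi\ge0\}$ is pointed and is minimally generated by its unique finite set of non-equivalent extreme rays (two rays are equivalent if they are positive multiples of each other); "number of extreme rays" counts non-equivalent ones. $\mathbb P^N$ is the joint law of $N$ IID samples of $\xi$. The SAA problem replaces $\mathbb E[f(\xi,x)]$ by $\frac1N\sum_{i=1}^N f(\xi_i,x)$; its feasible region is $\bigcap_{i=1}^N\{x\in\mathcal X:f(\xi_i,x)<+\infty\}$. The violation probability is $V(x)=\mathbb P(\xi\in\Xi:f(\xi,x)=+\infty)$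 for $x\in\mathcal X$. $\log$ is the natural logarithm. *)

theory Defs
  imports "HOL-Probability.Probability"
begin

section \<open>The two-stage problem\<close>

text \<open>
  The recourse function $f$. The order on \<^typ>\<open>real ^ 'p\<close> is componentwise, and
  \<^term>\<open>Inf {} = (\<infinity>::ereal)\<close> gives the value $+\infty$ when the second stage is infeasible.
\<close>

definition recourse ::
  "(real ^ 'r \<Rightarrow> real ^ 'p \<Rightarrow> ereal) \<Rightarrow> (real ^ 'r \<Rightarrow> real ^ 'p ^ 'm) \<Rightarrow>
   (real ^ 'r \<Rightarrow> real ^ 'n ^ 'm) \<Rightarrow> (real ^ 'r \<Rightarrow> real ^ 'm) \<Rightarrow>
   real ^ 'r \<Rightarrow> real ^ 'n \<Rightarrow> ereal"
  where "recourse g W T h \<zeta> x =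
    Inf {g \<zeta> y | y. W \<zeta> *v y + T \<zeta> *v x = h \<zeta> \<and> 0 \<le> y}"

definition lsc_on :: "'a::topological_space set \<Rightarrow> ('a \<Rightarrow> ereal) \<Rightarrow> bool"
  where "lsc_on S u \<longleftrightarrow> (\<forall>x\<in>S. u x \<le> Liminf (at x within S) u)"

text \<open>
  Positive part minus negative part; as \<^term>\<open>\<infinity> - \<infinity> = (\<infinity>::ereal)\<close>, the expectation is
  $+\infty$ whenever the positive part is not integrable.
\<close>

definition ereal_expectation :: "'a measure \<Rightarrow> ('a \<Rightarrow> ereal) \<Rightarrow> ereal"
  where "ereal_expectation M u =
    enn2ereal (\<integral>\<^sup>+ \<omega>. e2ennreal (u \<omega>) \<partial>M) - enn2ereal (\<integral>\<^sup>+ \<omega>. e2ennreal (- u \<omega>) \<partial>M)"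

definition objective ::
  "'a measure \<Rightarrow> ('a \<Rightarrow> 'c) \<Rightarrow> ('b \<Rightarrow> real) \<Rightarrow> ('c \<Rightarrow> 'b \<Rightarrow> ereal) \<Rightarrow> 'b \<Rightarrow> ereal"
  where "objective M \<xi> f0 f x = ereal (f0 x) + ereal_expectation M (\<lambda>\<omega>. f (\<xi> \<omega>) x)"

text \<open>
  Measurability for the completion of $\mathcal F \otimes \mathscr B$. No measure on the Borel
  sets of $X$ is distinguished, so the completion is the one with respect to the products of the
  given probability with all Borel probability measures on $X$. It contains
  $\mathcal F \otimes \mathscr B$.
\<close>

definition jointly_measurable ::
  "'a measure \<Rightarrow> 'b::topological_space set \<Rightarrow> ('a \<Rightarrow> 'b \<Rightarrow> ereal) \<Rightarrow> bool"
  where "jointly_measurable M X u \<longleftrightarrow>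
    (\<forall>\<mu>. prob_space \<mu> \<and> sets \<mu> = sets (restrict_space borel X) \<longrightarrow>
      (\<lambda>(\<omega>, x). u \<omega> x) \<in> borel_measurable (completion (M \<Otimes>\<^sub>M \<mu>)))"

definition l0norm :: "real ^ 'n \<Rightarrow> nat"
  where "l0norm x = card {i. x $ i \<noteq> 0}"


section \<open>Sampling\<close>

text \<open>
  The law of \<open>\<xi>\<close>, as a measure on \<open>\<Xi>\<close>, and the joint law of \<open>N\<close> independent
  samples, a measure on families indexed by \<open>{..<N}\<close>. Both are completed, which leaves the
  measure of Borel sets unchanged and makes the measurability assumptions weaker.
\<close>

definition law :: "'a measure \<Rightarrow> 'b::topological_space set \<Rightarrow> ('a \<Rightarrow> 'b) \<Rightarrow> 'b measure"
  where "law M \<Xi> \<xi> = completion (distr M (restrict_space borel \<Xi>) \<xi>)"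

definition sample_law :: "nat \<Rightarrow> 'b measure \<Rightarrow> (nat \<Rightarrow> 'b) measure"
  where "sample_law N P = completion (Pi\<^sub>M {..<N} (\<lambda>_. P))"

definition saa_feasible ::
  "nat \<Rightarrow> 'b set \<Rightarrow> ('c \<Rightarrow> 'b \<Rightarrow> ereal) \<Rightarrow> (nat \<Rightarrow> 'c) \<Rightarrow> 'b set"
  where "saa_feasible N X f s = {x \<in> X. \<forall>i<N. f (s i) x < \<infinity>}"

definition violation :: "'c measure \<Rightarrow> ('c \<Rightarrow> 'b \<Rightarrow> ereal) \<Rightarrow> 'b \<Rightarrow> real"
  where "violation P f x = measure P {\<zeta> \<in> space P. f \<zeta> x = \<infinity>}"


section \<open>Extreme rays\<close>

definition rows_independent :: "real ^ 'p ^ 'm \<Rightarrow> bool"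
  where "rows_independent A \<longleftrightarrow> inj (\<lambda>i. row i A) \<and> independent (rows A)"

definition dual_cone :: "real ^ 'p ^ 'm \<Rightarrow> (real ^ 'm) set"
  where "dual_cone A = {a. 0 \<le> a v* A}"

definition extreme_direction :: "'a::real_vector set \<Rightarrow> 'a \<Rightarrow> bool"
  where "extreme_direction C a \<longleftrightarrow> a \<in> C \<and> a \<noteq> 0 \<and>
    (\<forall>b\<in>C. \<forall>c\<in>C. a = b + c \<longrightarrow> (\<exists>s\<ge>0. b = s *\<^sub>R a) \<and> (\<exists>t\<ge>0. c = t *\<^sub>R a))"

text \<open>
  Extreme rays up to equivalence: one open half-line for each class of extreme directions
  that are positive multiples of each other.
\<close>

definition extreme_rays :: "'a::real_vector set \<Rightarrow> 'a set set"
  where "extreme_rays C = (\<lambda>a. {t *\<^sub>R a | t. 0 < t}) ` {a. extreme_direction C a}"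

text \<open>
  \<open>finite_J\<close> says that the maximum \<open>card_J\<close> exists and is finite. Neither \<^const>\<open>card\<close> nor
  \<^const>\<open>Max\<close> is meaningful on infinite sets.
\<close>

definition finite_J :: "('c \<Rightarrow> real ^ 'p ^ 'm) \<Rightarrow> 'c set \<Rightarrow> bool"
  where "finite_J W \<Xi> \<longleftrightarrow> (\<forall>\<zeta>\<in>\<Xi>. finite (extreme_rays (dual_cone (W \<zeta>)))) \<and>
    finite ((\<lambda>\<zeta>. card (extreme_rays (dual_cone (W \<zeta>)))) ` \<Xi>)"

definition card_J :: "('c \<Rightarrow> real ^ 'p ^ 'm) \<Rightarrow> 'c set \<Rightarrow> nat"
  where "card_J W \<Xi> = Max ((\<lambda>\<zeta>. card (extreme_rays (dual_cone (W \<zeta>)))) ` \<Xi>)"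

text \<open>
  For \<open>j = 0\<close> the last factor is \<^term>\<open>ln (0::real) = 0\<close>, so that \<open>d_VC n n0 0 = 0\<close>, in accordance
  with the convention $0 \log 0 = 0$.
\<close>

definition d_VC :: "nat \<Rightarrow> nat \<Rightarrow> nat \<Rightarrow> real"
  where "d_VC n n0 j =
    exp 1 / ((exp 1 - 1) * ln 2) * real j *
    (2 * (real n0 + 1) * log 2 ((real n * exp 1 + exp 1) / (real n0 + 1))) *
    ln (exp 1 / ln 2 * real j)"

end

theory Submission
  imports Defs
begin

text \<open>
  For a scenario with finite \<open>g\<close>, Farkas' lemma and the generation of the pointed cone
  \<open>dual_cone W\<close> by its extreme rays (Krein--Milman on a compact base) show that \<open>f = \<infinity>\<close> holds
  exactly when \<open>x\<close> lies in one of \<open>|J|\<close> open half-spaces. On \<open>2N\<close> scenarios the sparse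
  decisions therefore realise at most
  \<open>(n choose n0) * (\<Sum>i\<le>n0 + 1. 2 N |J| choose i)\<close> violation patterns, by Sauer--Shelah applied to
  each support of size \<open>n0\<close>.

  The tail bound comes from a ghost sample. Weight a pair of samples by \<open>2\<close> to the number of
  violations in the ghost sample if there is no violation in the first one. Given
  \<open>V(xstar) > \<epsilon>\<close>, the ghost average of the weight is at least \<open>(1 + \<epsilon>)^N\<close>; for a fixed violation
  pattern, its average over the \<open>2^N\<close> swaps of corresponding entries is at most \<open>1\<close>. So the
  probability is at most the number of patterns divided by \<open>(1 + \<epsilon>)^N\<close>, and \<open>d_VC\<close> is large
  enough to absorb that number.
\<close>

section \<open>Counting traces of half-spaces\<close>

definition shattered :: "'a set set \<Rightarrow> 'a set \<Rightarrow> bool"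
  where "shattered F B \<longleftrightarrow> (\<inter>) B ` F = Pow B"

lemma shatteredI:
  assumes "\<And>C. C \<subseteq> B \<Longrightarrow> \<exists>A\<in>F. B \<inter> A = C"
  shows "shattered F B"
  unfolding shattered_def
proof
  show "Pow B \<subseteq> (\<inter>) B ` F"
  proof
    fix C assume "C \<in> Pow B"
    with assms obtain A where "A \<in> F" "B \<inter> A = C" by (meson PowD)
    then show "C \<in> (\<inter>) B ` F" by (intro image_eqI[of C _ A]) simp_all
  qed
qed auto

lemma shatteredD: "shattered F B \<Longrightarrow> C \<subseteq> B \<Longrightarrow> \<exists>A\<in>F. B \<inter> A = C"
  unfolding shattered_def by (metis PowI imageE)

text \<open>Pajor's form of the Sauer--Shelah lemma. Split \<open>F\<close> by membership of a point
  \<open>a\<close>: by induction \<open>F0\<close> and \<open>F2\<close> each shatter enough subsets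
  of \<open>I\<close>. A set \<open>B\<close> shattered by both is rightly counted twice, since
  \<open>insert a B\<close> is then shattered as well.\<close>

lemma card_le_card_shattered:
  assumes "finite I" "F \<subseteq> Pow I"
  shows "card F \<le> card {B. B \<subseteq> I \<and> shattered F B}"
  using assms
proof (induction I arbitrary: F rule: finite_induct)
  case empty
  show ?case
  proof (cases "F = {}")
    case False
    with empty have "F = {{}}" by auto
    then have "shattered F {}" by (auto intro!: shatteredI)
    then have "{B. B \<subseteq> {} \<and> shattered F B} = {{}}" by blast
    with \<open>F = {{}}\<close> show ?thesis by (metis order_refl)
  qed simp
next
  case (insert a I)
  define F0 where "F0 = {A\<in>F. a \<notin> A}"
  define F1 where "F1 = {A\<in>F. a \<in> A}"
  define F2 where "F2 = (\<lambda>A. A - {a}) ` F1"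
  define S where "S G = {B. B \<subseteq> I \<and> shattered G B}" for G
  have fin: "finite F"
    using insert.hyps insert.prems by (auto intro: finite_subset[of F "Pow (insert a I)"])
  have finS: "finite (S G)" for G unfolding S_def using insert.hyps by auto
  have sub: "F0 \<subseteq> Pow I" "F2 \<subseteq> Pow I"
    using insert.prems unfolding F0_def F1_def F2_def by auto
  have "card F = card F0 + card F1"
  proof -
    have "F = F0 \<union> F1" "F0 \<inter> F1 = {}" unfolding F0_def F1_def by auto
    with fin show ?thesis by (metis card_Un_disjoint finite_Un)
  qed
  also have "card F1 = card F2"
    unfolding F2_def by (rule card_image[symmetric]) (auto simp: inj_on_def F1_def)
  also have "card F0 + card F2 \<le> card (S F0) + card (S F2)"
    using insert.IH[OF sub(1)] insert.IH[OF sub(2)] unfolding S_def by linarith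
  also have "\<dots> = card (S F0 \<union> S F2) + card (S F0 \<inter> S F2)"
    using finS by (intro card_Un_Int) auto
  also have "card (S F0 \<inter> S F2) = card (insert a ` (S F0 \<inter> S F2))"
    using insert.hyps by (intro card_image[symmetric]) (auto simp: inj_on_def S_def)
  also have "card (S F0 \<union> S F2) + card (insert a ` (S F0 \<inter> S F2))
      = card ((S F0 \<union> S F2) \<union> insert a ` (S F0 \<inter> S F2))"
    using finS insert.hyps by (intro card_Un_disjoint[symmetric]) (auto simp: S_def)
  also have "\<dots> \<le> card {B. B \<subseteq> insert a I \<and> shattered F B}"
  proof (rule card_mono)
    show "finite {B. B \<subseteq> insert a I \<and> shattered F B}" using insert.hyps by auto
    have 1: "shattered F B" if "shattered F0 B" for B
    proof (rule shatteredI)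
      fix C assume "C \<subseteq> B"
      from shatteredD[OF that this] show "\<exists>A\<in>F. B \<inter> A = C" unfolding F0_def by auto
    qed
    have 2: "shattered F B" if "shattered F2 B" "B \<subseteq> I" for B
    proof (rule shatteredI)
      fix C assume "C \<subseteq> B"
      from shatteredD[OF that(1) this] obtain A where "A \<in> F1" "B \<inter> (A - {a}) = C"
        unfolding F2_def by auto
      moreover have "B \<inter> (A - {a}) = B \<inter> A" using that(2) insert.hyps by auto
      ultimately show "\<exists>A\<in>F. B \<inter> A = C" unfolding F1_def by auto
    qed
    have 3: "shattered F (insert a B)" if "shattered F0 B" "shattered F2 B" "B \<subseteq> I" for B
    proof (rule shatteredI)
      fix C assume C: "C \<subseteq> insert a B"
      show "\<exists>A\<in>F. insert a B \<inter> A = C"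
      proof (cases "a \<in> C")
        case True
        have "C - {a} \<subseteq> B" using C by auto
        from shatteredD[OF that(2) this] obtain A where "A \<in> F1" "B \<inter> (A - {a}) = C - {a}"
          unfolding F2_def by auto
        moreover from this have "insert a B \<inter> A = insert a (B \<inter> (A - {a}))"
          using that(3) insert.hyps unfolding F1_def by auto
        ultimately have "A \<in> F" "insert a B \<inter> A = C"
          using True unfolding F1_def by auto
        then show ?thesis by blast
      next
        case False
        then have "C \<subseteq> B" using C by auto
        from shatteredD[OF that(1) this] show ?thesis using False unfolding F0_def by auto
      qed
    qed
    show "(S F0 \<union> S F2) \<union> insert a ` (S F0 \<inter> S F2) \<subseteq> {B. B \<subseteq> insert a I \<and> shattered F B}"
      using 1 2 3 unfolding S_def by blast
  qed
  finally show ?case .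
qed

lemma sauer_shelah:
  assumes "finite I" "F \<subseteq> Pow I"
    and "\<And>B. B \<subseteq> I \<Longrightarrow> shattered F B \<Longrightarrow> card B \<le> k"
  shows "card F \<le> (\<Sum>i\<le>k. card I choose i)"
proof -
  have "card F \<le> card {B. B \<subseteq> I \<and> shattered F B}"
    by (rule card_le_card_shattered[OF assms(1,2)])
  also have "\<dots> \<le> card (\<Union>i\<le>k. {B. B \<subseteq> I \<and> card B = i})"
    using assms by (intro card_mono) auto
  also have "\<dots> \<le> (\<Sum>i\<le>k. card {B. B \<subseteq> I \<and> card B = i})"
    by (rule card_UN_le) auto
  finally show ?thesis by (simp add: n_subsets[OF assms(1)])
qed

text \<open>Chernoff's trick: \<open>t ^ k \<le> t ^ i\<close> for \<open>i \<le> k\<close>, and the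
  completed weighted sum is the binomial expansion of \<open>(1 + t) ^ m\<close>. The parameter
  stays free because two different choices are made later.\<close>

lemma sum_choose_le:
  fixes t :: real
  assumes "0 < t" "t \<le> 1"
  shows "(\<Sum>i\<le>k. real (m choose i)) \<le> (1 + t) ^ m / t ^ k"
proof -
  have "t ^ k * (\<Sum>i\<le>k. real (m choose i)) \<le> (\<Sum>i\<le>k. real (m choose i) * t ^ i)"
    unfolding sum_distrib_left
    by (intro sum_mono) (use assms in \<open>auto simp: mult.commute intro!: mult_right_mono power_decreasing\<close>)
  \<comment> \<open>The range up to \<open>k + m\<close> contains both \<open>{..k}\<close> and
    \<open>{..m}\<close>; the binomials beyond \<open>m\<close> vanish.\<close>
  also have "\<dots> \<le> (\<Sum>i\<le>k + m. real (m choose i) * t ^ i)"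
    using assms by (intro sum_mono2) auto
  also have "\<dots> = (\<Sum>i\<le>m. real (m choose i) * t ^ i)"
    by (intro sum.mono_neutral_right) auto
  also have "\<dots> = (1 + t) ^ m"
    using binomial_ring[of t 1 m] by (simp add: add.commute)
  finally show ?thesis
    using assms by (simp add: field_simps)
qed

section \<open>Half-spaces, sparse decisions and unions of half-spaces\<close>

text \<open>A set with more elements than a spanning set is dependent. In an indexed family a
  repetition is a case of its own, with coefficients 1 and -1; negating the relation if necessary
  makes one coefficient positive.\<close>

lemma dependent_family:
  fixes p :: "'i \<Rightarrow> 'a::real_vector"
  assumes "finite B" "finite T" "p ` B \<subseteq> span T" "card T < card B"
  obtains c where "(\<Sum>i\<in>B. c i *\<^sub>R p i) = 0" "\<exists>i\<in>B. 0 < (c i :: real)"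
proof -
  have "\<exists>c. (\<Sum>i\<in>B. c i *\<^sub>R p i) = 0 \<and> (\<exists>i\<in>B. c i \<noteq> (0::real))"
  proof (cases "inj_on p B")
    case True
    have "dependent (p ` B)"
      using independent_span_bound[OF assms(2) _ assms(3)] assms(4) card_image[OF True] by auto
    then obtain u v where uv: "(\<Sum>v\<in>p ` B. u v *\<^sub>R v) = 0" "v \<in> p ` B" "u v \<noteq> 0"
      using dependent_finite[of "p ` B"] assms(1) by auto
    then show ?thesis
      by (intro exI[of _ "u \<circ> p"]) (auto simp: sum.reindex[OF True])
  next
    case False
    then obtain i j where ij: "i \<in> B" "j \<in> B" "i \<noteq> j" "p i = p j" by (auto simp: inj_on_def)
    let ?c = "\<lambda>l. if l = i then 1 else if l = j then -1 else (0::real)"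
    have "(\<Sum>l\<in>B. ?c l *\<^sub>R p l) = (\<Sum>l\<in>{i,j}. ?c l *\<^sub>R p l)"
      using ij assms(1) by (intro sum.mono_neutral_right) auto
    then show ?thesis using ij by (intro exI[of _ ?c]) auto
  qed
  then obtain c l where c: "(\<Sum>i\<in>B. c i *\<^sub>R p i) = 0" "l \<in> B" "c l \<noteq> (0::real)" by auto
  show thesis
  proof (cases "0 < c l")
    case True
    then show thesis using c that by blast
  next
    case False
    then show thesis using c by (intro that[of "\<lambda>i. - c i"] bexI[of _ l]) (auto simp: sum_negf)
  qed
qed

text \<open>The VC dimension of homogeneous half-spaces is at most the linear dimension. A larger
  shattered set carries a relation with coefficients \<open>c\<close>; a \<open>v\<close> with
  \<open>p i \<bullet> v < 0\<close> exactly where \<open>0 < c i\<close> makes every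
  \<open>c i * (p i \<bullet> v)\<close> nonpositive and one negative, although they sum to
  0.\<close>

lemma card_halfspace_traces_le:
  fixes p :: "'i \<Rightarrow> 'a::real_inner"
  assumes "finite I" "finite T" "p ` I \<subseteq> span T"
  shows "card ((\<lambda>v. {i\<in>I. p i \<bullet> v < 0}) ` V) \<le> (\<Sum>i\<le>card T. card I choose i)"
proof (rule sauer_shelah[OF assms(1)])
  show "(\<lambda>v. {i\<in>I. p i \<bullet> v < 0}) ` V \<subseteq> Pow I" by auto
  fix B assume B: "B \<subseteq> I" "shattered ((\<lambda>v. {i\<in>I. p i \<bullet> v < 0}) ` V) B"
  have fB: "finite B" using B(1) assms(1) finite_subset by auto
  show "card B \<le> card T"
  proof (rule ccontr)
    assume "\<not> card B \<le> card T"
    then have "card T < card B" "p ` B \<subseteq> span T" using B(1) assms(3) by auto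
    then obtain c where c: "(\<Sum>i\<in>B. c i *\<^sub>R p i) = 0" "\<exists>i\<in>B. 0 < (c i :: real)"
      using dependent_family[OF fB assms(2), of p] by metis
    from shatteredD[OF B(2), of "{i\<in>B. 0 < c i}"]
    obtain v where v: "B \<inter> {i\<in>I. p i \<bullet> v < 0} = {i\<in>B. 0 < c i}" by auto
    have neg: "c i * (p i \<bullet> v) \<le> 0" if "i \<in> B" for i
    proof -
      have "p i \<bullet> v < 0 \<longleftrightarrow> 0 < c i" using v that B(1) by blast
      then show ?thesis by (smt (verit) mult_nonneg_nonneg mult_nonneg_nonpos mult_nonpos_nonneg)
    qed
    obtain i where i: "i \<in> B" "0 < c i" using c(2) by auto
    then have "p i \<bullet> v < 0" using v B(1) by blast
    then have "c i * (p i \<bullet> v) < 0" using i by (simp add: mult_pos_neg)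
    then have "(\<Sum>i\<in>B. c i * (p i \<bullet> v)) < (\<Sum>i\<in>B. 0)"
      using i neg fB by (intro sum_strict_mono_ex1) auto
    moreover have "(\<Sum>i\<in>B. c i * (p i \<bullet> v)) = (\<Sum>i\<in>B. c i *\<^sub>R p i) \<bullet> v"
      by (simp add: inner_sum_left)
    ultimately show False using c(1) by simp
  qed
qed

text \<open>The choice \<open>t = k / m\<close> in \<open>sum_choose_le\<close>, for which
  \<open>(1 + t) ^ m \<le> exp 1 ^ k\<close>.\<close>

lemma choose_le_exp_power:
  assumes "1 \<le> k" "k \<le> m"
  shows "real (m choose k) \<le> (real m * exp 1 / real k) ^ k"
proof -
  define t where "t = real k / real m"
  have t: "0 < t" "t \<le> 1" using assms by (auto simp: t_def)
  have "real (m choose k) \<le> (\<Sum>i\<le>k. real (m choose i))"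
    by (rule member_le_sum) auto
  also have "\<dots> \<le> (1 + t) ^ m / t ^ k" by (rule sum_choose_le[OF t])
  also have "\<dots> \<le> exp t ^ m / t ^ k"
    using t by (intro divide_right_mono power_mono) (auto simp: exp_ge_add_one_self)
  also have "exp t ^ m = exp 1 ^ k"
    using assms by (simp add: exp_of_nat_mult[symmetric] t_def)
  also have "exp 1 ^ k / t ^ k = (real m * exp 1 / real k) ^ k"
    by (simp add: t_def power_divide power_mult_distrib mult.commute)
  finally show ?thesis .
qed

text \<open>A decision supported in \<open>S\<close> sees only the constant term and the coordinates
  in \<open>S\<close>, so its affine conditions become homogeneous half-spaces in dimension
  \<open>n0 + 1\<close>. The factor in front is a union bound over the supports.\<close>

lemma card_sparse_halfspace_traces_le:
  fixes \<alpha> :: "'i \<Rightarrow> real" and \<beta> :: "'i \<Rightarrow> real ^ 'n"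
  assumes "finite I" "n0 \<le> CARD('n)" "X \<subseteq> {x. l0norm x \<le> n0}"
  shows "card ((\<lambda>x. {i\<in>I. \<alpha> i + \<beta> i \<bullet> x < 0}) ` X)
    \<le> (CARD('n) choose n0) * (\<Sum>i\<le>n0 + 1. card I choose i)"
proof -
  define SS where "SS = {S :: 'n set. card S = n0}"
  define p where "p S i = (\<alpha> i, \<chi> j. if j \<in> S then \<beta> i $ j else 0)" for S i
  define F where "F S = (\<lambda>v. {i\<in>I. p S i \<bullet> v < 0}) ` UNIV" for S
  have card_F: "card (F S) \<le> (\<Sum>i\<le>n0 + 1. card I choose i)" if "S \<in> SS" for S
  proof -
    define T :: "(real \<times> (real ^ 'n)) set" where "T = insert (1, 0) ((\<lambda>j. (0, axis j 1)) ` S)"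
    have "finite T" by (simp add: T_def)
    have span: "p S i \<in> span T" for i
    proof -
      have "(\<Sum>j\<in>S. \<beta> i $ j *\<^sub>R axis j (1::real)) = (\<chi> j. if j \<in> S then \<beta> i $ j else 0)"
        by (simp add: vec_eq_iff axis_def if_distrib cong: if_cong)
      then have "p S i = \<alpha> i *\<^sub>R (1, 0) + (\<Sum>j\<in>S. \<beta> i $ j *\<^sub>R (0, axis j 1))"
        by (simp add: p_def prod_eq_iff fst_sum snd_sum)
      moreover have "\<alpha> i *\<^sub>R (1, 0) + (\<Sum>j\<in>S. \<beta> i $ j *\<^sub>R (0, axis j 1)) \<in> span T"
        by (intro span_add span_scale span_sum span_base) (auto simp: T_def)
      ultimately show ?thesis by metis
    qed
    have "card T \<le> Suc (card ((\<lambda>j. (0 :: real, axis j (1::real))) ` S))"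
      unfolding T_def by (rule card_insert_le_m1) auto
    then have "card T \<le> n0 + 1"
      using card_image_le[of S "\<lambda>j. (0 :: real, axis j (1::real))"] that by (simp add: SS_def)
    have "card (F S) \<le> (\<Sum>i\<le>card T. card I choose i)"
      unfolding F_def using span
      by (intro card_halfspace_traces_le[OF assms(1) \<open>finite T\<close>]) auto
    also have "\<dots> \<le> (\<Sum>i\<le>n0 + 1. card I choose i)"
      using \<open>card T \<le> n0 + 1\<close> by (intro sum_mono2) auto
    finally show ?thesis .
  qed
  have "(\<lambda>x. {i\<in>I. \<alpha> i + \<beta> i \<bullet> x < 0}) ` X \<subseteq> (\<Union>S\<in>SS. F S)"
  proof
    fix A assume "A \<in> (\<lambda>x. {i\<in>I. \<alpha> i + \<beta> i \<bullet> x < 0}) ` X"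
    then obtain x where x: "x \<in> X" "A = {i\<in>I. \<alpha> i + \<beta> i \<bullet> x < 0}" by auto
    have "card {i. x $ i \<noteq> 0} \<le> n0" using x(1) assms(3) by (auto simp: l0norm_def)
    \<comment> \<open>The support is enlarged to exactly \<open>n0\<close> coordinates, which
      \<open>n0 \<le> CARD('n)\<close> permits.\<close>
    then obtain S where S: "{i. x $ i \<noteq> 0} \<subseteq> S" "card S = n0"
      using exists_subset_between[of "{i. x $ i \<noteq> 0}" n0 UNIV] assms(2) by auto
    have "p S i \<bullet> (1, x) = \<alpha> i + \<beta> i \<bullet> x" for i
    proof -
      have "(\<chi> j. if j \<in> S then \<beta> i $ j else 0) \<bullet> x = \<beta> i \<bullet> x"
        unfolding inner_vec_def using S(1) by (intro sum.cong) auto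
      then show ?thesis by (simp add: p_def)
    qed
    then have "A \<in> F S" unfolding F_def x(2) by (intro image_eqI[of _ _ "(1, x)"]) auto
    then show "A \<in> (\<Union>S\<in>SS. F S)" using S(2) by (auto simp: SS_def)
  qed
  moreover have "finite (\<Union>S\<in>SS. F S)"
    by (rule finite_subset[of _ "Pow I"]) (use assms(1) in \<open>auto simp: F_def\<close>)
  ultimately have "card ((\<lambda>x. {i\<in>I. \<alpha> i + \<beta> i \<bullet> x < 0}) ` X) \<le> card (\<Union>S\<in>SS. F S)"
    by (intro card_mono)
  also have "\<dots> \<le> (\<Sum>S\<in>SS. card (F S))" by (rule card_UN_le) auto
  also have "\<dots> \<le> (\<Sum>S\<in>SS. \<Sum>i\<le>n0 + 1. card I choose i)" by (intro sum_mono card_F)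
  also have "\<dots> = card SS * (\<Sum>i\<le>n0 + 1. card I choose i)" by simp
  also have "card SS = CARD('n) choose n0"
    using n_subsets[of "UNIV :: 'n set" n0] by (simp add: SS_def)
  finally show ?thesis .
qed

text \<open>A pattern of unions is the image under \<open>fst\<close> of a pattern of single
  half-spaces indexed by \<open>I \<times> {..<k}\<close>, so there are no more of the
  former.\<close>

lemma card_union_halfspace_traces_le:
  fixes \<alpha> :: "'i \<Rightarrow> nat \<Rightarrow> real" and \<beta> :: "'i \<Rightarrow> nat \<Rightarrow> real ^ 'n"
  assumes "finite I" "n0 \<le> CARD('n)" "X \<subseteq> {x. l0norm x \<le> n0}"
  shows "card ((\<lambda>x. {i\<in>I. \<exists>l<k. \<alpha> i l + \<beta> i l \<bullet> x < 0}) ` X)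
    \<le> (CARD('n) choose n0) * (\<Sum>i\<le>n0 + 1. (card I * k) choose i)"
proof -
  define H where "H x = {q \<in> I \<times> {..<k}. case_prod \<alpha> q + case_prod \<beta> q \<bullet> x < 0}" for x
  have "(\<lambda>x. {i\<in>I. \<exists>l<k. \<alpha> i l + \<beta> i l \<bullet> x < 0}) ` X = (`) fst ` H ` X"
    unfolding image_image by (intro image_cong refl) (force simp: H_def image_iff)
  also have "card \<dots> \<le> card (H ` X)"
    by (intro card_image_le finite_subset[of "H ` X" "Pow (I \<times> {..<k})"])
      (use assms(1) in \<open>auto simp: H_def\<close>)
  also have "\<dots> \<le> (CARD('n) choose n0) * (\<Sum>i\<le>n0 + 1. card (I \<times> {..<k}) choose i)"
    unfolding H_def using assms by (intro card_sparse_halfspace_traces_le) auto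
  finally show ?thesis using assms(1) by (simp add: card_cartesian_product)
qed

section \<open>Infeasibility of linear systems and extreme rays\<close>

text \<open>A finitely generated cone is closed, so \<open>b\<close> can be strictly separated from
  the cone of the columns.\<close>

lemma farkas:
  fixes A :: "real ^ 'p ^ 'm"
  assumes "\<nexists>y. A *v y = b \<and> 0 \<le> y"
  obtains a where "a \<in> dual_cone A" "a \<bullet> b < 0"
proof -
  define K where "K = convex_cone hull (columns A)"
  have K: "convex_cone K" unfolding K_def by (rule convex_cone_convex_cone_hull)
  have "convex_cone {A *v y | y. 0 \<le> y}"
    unfolding convex_cone_iff
  proof (intro conjI ballI allI impI)
    show "0 \<in> {A *v y | y. 0 \<le> y}" by (auto intro!: exI[of _ 0])
  next
    fix u v assume "u \<in> {A *v y | y. 0 \<le> y}" "v \<in> {A *v y | y. 0 \<le> y}"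
    then obtain y z where "u = A *v y" "0 \<le> y" "v = A *v z" "0 \<le> z" by auto
    then show "u + v \<in> {A *v y | y. 0 \<le> y}"
      by (auto intro!: exI[of _ "y + z"] simp: matrix_vector_right_distrib)
  next
    fix u and c :: real assume "u \<in> {A *v y | y. 0 \<le> y}" "0 \<le> c"
    then obtain y where "u = A *v y" "0 \<le> y" by auto
    then show "c *\<^sub>R u \<in> {A *v y | y. 0 \<le> y}"
      using \<open>0 \<le> c\<close>
      by (auto intro!: exI[of _ "c *\<^sub>R y"] scaleR_nonneg_nonneg simp: matrix_vector_mult_scaleR)
  qed
  moreover have "columns A \<subseteq> {A *v y | y. 0 \<le> y}"
  proof
    fix c assume "c \<in> columns A"
    then obtain j where "c = A *v axis j 1"
      by (auto simp: columns_def matrix_vector_mult_basis)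
    moreover have "0 \<le> (axis j 1 :: real ^ 'p)" by (auto simp: less_eq_vec_def axis_def)
    ultimately show "c \<in> {A *v y | y. 0 \<le> y}" by auto
  qed
  ultimately have "K \<subseteq> {A *v y | y. 0 \<le> y}"
    unfolding K_def by (intro hull_minimal)
  then have "b \<notin> K" using assms by auto
  moreover have "closed K" unfolding K_def by (rule closed_convex_cone_hull) (simp add: columns_def full_SetCompr_eq)
  moreover have "convex K" using K by (simp add: convex_cone_def)
  ultimately obtain a \<beta> where a: "a \<bullet> b < \<beta>" "\<And>x. x \<in> K \<Longrightarrow> \<beta> < a \<bullet> x"
    using separating_hyperplane_closed_point by metis
  have "\<beta> < 0" using a(2)[of 0] convex_cone_contains_0[OF K] by simp
  \<comment> \<open>A point with negative value could be scaled within the cone to the value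
    \<open>\<beta>\<close>, against strict separation.\<close>
  have "0 \<le> a \<bullet> x" if "x \<in> K" for x
  proof (rule ccontr)
    assume neg: "\<not> 0 \<le> a \<bullet> x"
    then have "(\<beta> / (a \<bullet> x)) *\<^sub>R x \<in> K"
      using K that \<open>\<beta> < 0\<close> by (intro convex_cone_scaleR) (auto simp: divide_nonpos_neg)
    from a(2)[OF this] neg show False by simp
  qed
  moreover have "column j A \<in> K" for j
    unfolding K_def by (rule hull_inc) (auto simp: columns_def)
  ultimately have "0 \<le> a \<bullet> column j A" for j by simp
  then have "a \<in> dual_cone A"
    by (auto simp: dual_cone_def less_eq_vec_def vector_matrix_mult_def inner_vec_def column_def
        mult.commute)
  with a(1) \<open>\<beta> < 0\<close> show thesis by (intro that) auto
qed

lemma vector_matrix_mult_eq_0: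
  fixes A :: "real ^ 'p ^ 'm"
  assumes "rows_independent A" "a v* A = 0"
  shows "a = 0"
proof -
  have inj: "inj (\<lambda>i. row i A)" and ind: "independent (rows A)"
    using assms(1) by (auto simp: rows_independent_def)
  have rows: "rows A = range (\<lambda>i. row i A)" by (auto simp: rows_def)
  define u where "u v = a $ (inv (\<lambda>i. row i A) v)" for v
  have "(\<Sum>v\<in>rows A. u v *\<^sub>R v) = (\<Sum>i\<in>UNIV. a $ i *\<^sub>R row i A)"
    unfolding rows by (subst sum.reindex[OF inj]) (simp add: u_def inv_f_f[OF inj])
  also have "\<dots> = a v* A"
    by (simp add: vec_eq_iff vector_matrix_mult_def row_def mult.commute)
  finally have "(\<Sum>v\<in>rows A. u v *\<^sub>R v) = 0" using assms(2) by simp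
  then have "u (row i A) = 0" for i
    using independentD[OF ind _ subset_refl] by (auto simp: rows)
  then show ?thesis by (simp add: vec_eq_iff u_def inv_f_f[OF inj])
qed

text \<open>A base of the cone meets the ray of \<open>a\<close> and is the convex hull of its
  extreme points, so one of these is also negative on \<open>b\<close>. Extreme points of the base
  are extreme directions of the cone.\<close>

lemma extreme_direction_separates:
  fixes A :: "real ^ 'p ^ 'm"
  assumes "rows_independent A" "a \<in> dual_cone A" "a \<bullet> b < 0"
  obtains e where "extreme_direction (dual_cone A) e" "e \<bullet> b < 0"
proof -
  define C where "C = dual_cone A"
  \<comment> \<open>Pairing with \<open>u\<close> sums the entries of \<open>c v* A\<close>. This
    height is positive on the cone except at 0, so the level 1 cuts out a base.\<close>
  define u where "u = A *v 1"
  have u: "c \<bullet> u = (\<Sum>j\<in>UNIV. (c v* A) $ j)" for c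
    unfolding u_def by (simp flip: dot_lmul_matrix) (simp add: inner_vec_def)
  have comp: "0 \<le> (c v* A) $ j" if "c \<in> C" for c j
    using that by (auto simp: C_def dual_cone_def less_eq_vec_def)
  have nonneg: "0 \<le> c \<bullet> u" if "c \<in> C" for c
    unfolding u using comp[OF that] by (intro sum_nonneg) auto
  have zero: "c = 0" if "c \<in> C" "c \<bullet> u = 0" for c
  proof -
    have "(c v* A) $ j = 0" for j
      using that(2) comp[OF that(1)] unfolding u by (subst (asm) sum_nonneg_eq_0_iff) auto
    then show ?thesis by (intro vector_matrix_mult_eq_0[OF assms(1)]) (simp add: vec_eq_iff)
  qed
  have scale: "t *\<^sub>R c \<in> C" if "c \<in> C" "0 \<le> t" for c t
  proof -
    have "(t *\<^sub>R c) v* A = t *\<^sub>R (c v* A)"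
      by (simp add: vec_eq_iff vector_matrix_mult_def sum_distrib_left mult_ac)
    then show ?thesis using that by (auto simp: C_def dual_cone_def scaleR_nonneg_nonneg)
  qed
  \<comment> \<open>The compact base of the cone to which Krein--Milman applies.\<close>
  define S where "S = {c \<in> C. c \<bullet> u = 1}"
  have lin: "linear (\<lambda>c. c v* A)"
    using matrix_vector_mul_linear[of "transpose A"] by simp
  have inj: "inj (\<lambda>c. c v* A)"
    using linear_injective_0[OF lin] vector_matrix_mult_eq_0[OF assms(1)] by auto
  have cont: "continuous_on UNIV (\<lambda>c. c v* A)"
    using lin by (simp add: linear_continuous_on linear_conv_bounded_linear)
  have C_eq: "C = (\<Inter>j. {c. 0 \<le> (c v* A) $ j})"
    by (auto simp: C_def dual_cone_def less_eq_vec_def)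
  have "convex C"
    unfolding C_def dual_cone_def
    using convex_linear_vimage[OF lin, of "{w. 0 \<le> w}"] 
    by (simp add: vimage_def convex_def add_nonneg_nonneg scaleR_nonneg_nonneg)
  moreover have "closed C"
    unfolding C_eq
    by (intro closed_INT ballI closed_Collect_le continuous_intros
        continuous_on_subset[OF cont] continuous_on_component) auto
  moreover have "S = C \<inter> {c. u \<bullet> c = 1}" by (auto simp: S_def inner_commute)
  ultimately have "convex S" "closed S"
    by (auto intro: convex_Int convex_hyperplane closed_hyperplane)
  \<comment> \<open>Independent rows make the map to \<open>c v* A\<close> injective, hence bounded
    below; on the base the nonnegative entries of \<open>c v* A\<close> sum to 1, which bounds the
    base.\<close>
  obtain B where B: "0 < B" "\<And>c. B * norm c \<le> norm (c v* A)"
    using linear_inj_bounded_below_pos[OF lin inj] by metis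
  have "norm c \<le> 1 / B" if "c \<in> S" for c
  proof -
    have "norm (c v* A) \<le> (\<Sum>j\<in>UNIV. \<bar>(c v* A) $ j\<bar>)" by (rule norm_le_l1_cart)
    also have "\<dots> = (\<Sum>j\<in>UNIV. (c v* A) $ j)"
      using that comp by (intro sum.cong) (auto simp: S_def)
    also have "\<dots> = 1" using that by (simp add: S_def flip: u)
    finally show ?thesis using B(1) B(2)[of c] by (simp add: field_simps)
  qed
  then have "bounded S" by (auto simp: bounded_iff)
  with \<open>closed S\<close> have "compact S" by (simp add: compact_eq_bounded_closed)
  with \<open>convex S\<close> have hull: "S = convex hull {x. x extreme_point_of S}"
    by (intro Krein_Milman_Minkowski)
  have "a \<in> C" using assms(2) by (simp add: C_def)
  have "a \<noteq> 0" using assms(3) by auto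
  then have "0 < a \<bullet> u" using zero[OF \<open>a \<in> C\<close>] nonneg[OF \<open>a \<in> C\<close>] by fastforce
  define a' where "a' = (1 / (a \<bullet> u)) *\<^sub>R a"
  have "a' \<in> S"
    using \<open>0 < a \<bullet> u\<close> scale[OF \<open>a \<in> C\<close>, of "1 / (a \<bullet> u)"] by (auto simp: S_def a'_def)
  have "a' \<bullet> b < 0"
    using assms(3) \<open>0 < a \<bullet> u\<close> by (simp add: a'_def divide_neg_pos)
  have "\<exists>e. e extreme_point_of S \<and> e \<bullet> b < 0"
  proof (rule ccontr)
    assume "\<not> ?thesis"
    then have "{x. x extreme_point_of S} \<subseteq> {x. b \<bullet> x \<ge> 0}"
      by (auto simp: not_less inner_commute)
    then have "S \<subseteq> {x. b \<bullet> x \<ge> 0}"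
      by (subst hull) (intro hull_minimal convex_halfspace_ge)
    with \<open>a' \<in> S\<close> \<open>a' \<bullet> b < 0\<close> show False by (auto simp: inner_commute)
  qed
  then obtain e where e: "e extreme_point_of S" "e \<bullet> b < 0" by auto
  then have eS: "e \<in> C" "e \<bullet> u = 1" by (auto simp: extreme_point_of_def S_def)
  \<comment> \<open>Both summands are rescaled to height 1, which writes \<open>e\<close> as a
    proper convex combination of points of \<open>S\<close>; extremality forces these to coincide. A
    summand of height 0 is itself 0.\<close>
  have key: "\<exists>s\<ge>0. v = s *\<^sub>R e" if vw: "v \<in> C" "w \<in> C" "e = v + w" for v w
  proof -
    define \<beta> where "\<beta> = v \<bullet> u"
    define \<gamma> where "\<gamma> = w \<bullet> u"
    have sum1: "\<beta> + \<gamma> = 1" using eS(2) vw(3) by (simp add: \<beta>_def \<gamma>_def inner_add_left)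
    have pos: "0 \<le> \<beta>" "0 \<le> \<gamma>" using nonneg vw by (auto simp: \<beta>_def \<gamma>_def)
    consider "\<beta> = 0" | "\<gamma> = 0" | "0 < \<beta>" "0 < \<gamma>" using pos by linarith
    then show ?thesis
    proof cases
      case 1
      then have "v = 0" using zero[OF vw(1)] by (simp add: \<beta>_def)
      then show ?thesis by (intro exI[of _ 0]) auto
    next
      case 2
      then have "w = 0" using zero[OF vw(2)] by (simp add: \<gamma>_def)
      then show ?thesis using vw(3) by (intro exI[of _ 1]) auto
    next
      case 3
      define v' where "v' = (1 / \<beta>) *\<^sub>R v"
      define w' where "w' = (1 / \<gamma>) *\<^sub>R w"
      have "v' \<in> S" "w' \<in> S"
        using 3 scale[OF vw(1), of "1/\<beta>"] scale[OF vw(2), of "1/\<gamma>"]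
        by (auto simp: S_def v'_def w'_def \<beta>_def[symmetric] \<gamma>_def[symmetric])
      then have "e \<notin> open_segment v' w'" using e(1) by (auto simp: extreme_point_of_def)
      moreover have "e = (1 - \<gamma>) *\<^sub>R v' + \<gamma> *\<^sub>R w'"
      proof -
        have "1 - \<gamma> = \<beta>" using sum1 by simp
        then show ?thesis using 3 vw(3) by (simp add: v'_def w'_def)
      qed
      moreover have "\<gamma> < 1" using 3 sum1 by linarith
      ultimately have "v' = w'" using 3 unfolding in_segment by blast
      with \<open>e = (1 - \<gamma>) *\<^sub>R v' + \<gamma> *\<^sub>R w'\<close> have "e = v'" by (simp flip: scaleR_left_distrib)
      then have "v = \<beta> *\<^sub>R e" using 3 by (simp add: v'_def)
      then show ?thesis using 3 by (intro exI[of _ \<beta>]) auto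
    qed
  qed
  have "extreme_direction C e"
    unfolding extreme_direction_def
  proof (intro conjI ballI impI)
    fix v w assume "v \<in> C" "w \<in> C" "e = v + w"
    then show "\<exists>s\<ge>0. v = s *\<^sub>R e" "\<exists>t\<ge>0. w = t *\<^sub>R e"
      using key[of v w] key[of w v] by (auto simp: add.commute)
  qed (use eS in auto)
  with e(2) show thesis by (intro that) (auto simp: C_def)
qed

text \<open>Farkas' lemma with the certificate replaced by an extreme direction. The count
  \<open>k\<close> is only an upper bound, so that one \<open>k\<close> can serve all
  scenarios.\<close>

lemma infeasible_iff_extreme_rays:
  fixes A :: "real ^ 'p ^ 'm"
  assumes "rows_independent A" "finite (extreme_rays (dual_cone A))"
    and "card (extreme_rays (dual_cone A)) \<le> k"
  shows "\<exists>e :: nat \<Rightarrow> real ^ 'm. \<forall>b. (\<exists>y. A *v y = b \<and> 0 \<le> y) \<longleftrightarrow> (\<forall>l<k. 0 \<le> e l \<bullet> b)"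
proof -
  define R where "R = extreme_rays (dual_cone A)"
  define c where "c = card R"
  obtain r where r: "bij_betw r {0..<c} R"
    using ex_bij_betw_nat_finite assms(2) unfolding c_def R_def by blast
  \<comment> \<open>One representative per ray; surplus indices get 0, whose inequality is
    vacuous.\<close>
  define e where "e l = (if l < c then (SOME a. extreme_direction (dual_cone A) a \<and>
    r l = {t *\<^sub>R a | t. 0 < t}) else 0)" for l
  have e: "extreme_direction (dual_cone A) (e l) \<and> r l = {t *\<^sub>R e l | t. 0 < t}" if "l < c" for l
  proof -
    have "r l \<in> R" using r that by (auto simp: bij_betw_def)
    then have "\<exists>a. extreme_direction (dual_cone A) a \<and> r l = {t *\<^sub>R a | t. 0 < t}"
      by (auto simp: R_def extreme_rays_def)
    from someI_ex[OF this] show ?thesis using that by (simp add: e_def)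
  qed
  have "(\<exists>y. A *v y = b \<and> 0 \<le> y) \<longleftrightarrow> (\<forall>l<k. 0 \<le> e l \<bullet> b)" for b
  proof
    assume "\<exists>y. A *v y = b \<and> 0 \<le> y"
    then obtain y where y: "A *v y = b" "0 \<le> y" by auto
    show "\<forall>l<k. 0 \<le> e l \<bullet> b"
    proof (intro allI impI)
      fix l assume "l < k"
      have "e l \<in> dual_cone A"
      proof (cases "l < c")
        case True
        then show ?thesis using e[of l] by (simp add: extreme_direction_def)
      next
        case False
        then have "e l = 0" by (simp add: e_def)
        then show ?thesis by (simp add: dual_cone_def)
      qed
      then have "0 \<le> (e l v* A) \<bullet> y"
        using y(2) unfolding dual_cone_def less_eq_vec_def inner_vec_def
        by (intro sum_nonneg) simp
      then show "0 \<le> e l \<bullet> b" using y(1) by (simp add: dot_lmul_matrix)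
    qed
  next
    assume nn: "\<forall>l<k. 0 \<le> e l \<bullet> b"
    show "\<exists>y. A *v y = b \<and> 0 \<le> y"
    proof (rule ccontr)
      assume "\<not> ?thesis"
      then obtain a where "a \<in> dual_cone A" "a \<bullet> b < 0" by (rule farkas)
      then obtain d where d: "extreme_direction (dual_cone A) d" "d \<bullet> b < 0"
        using extreme_direction_separates[OF assms(1)] by metis
      then have "{t *\<^sub>R d | t. 0 < t} \<in> R" by (auto simp: R_def extreme_rays_def)
      then obtain l where l: "l < c" "r l = {t *\<^sub>R d | t. 0 < t}"
        using r unfolding bij_betw_def by (metis (no_types, lifting) atLeast0LessThan imageE lessThan_iff)
      have "d \<in> {t *\<^sub>R d | t. 0 < t}" by (auto intro!: exI[of _ 1])
      then have "d \<in> {t *\<^sub>R e l | t. 0 < t}" using e[OF l(1)] l(2) by metis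
      then obtain t where "d = t *\<^sub>R e l" "0 < t" by auto
      then have "e l \<bullet> b < 0" using d(2) by (auto simp: mult_less_0_iff)
      moreover have "l < k" using l(1) assms(3) by (simp add: c_def R_def)
      ultimately show False using nn by fastforce
    qed
  qed
  then show ?thesis by auto
qed

section \<open>Symmetrisation with a ghost sample\<close>

text \<open>
  \<open>alg\<close>, \<open>E\<close> and \<open>G\<close> are kept apart so that no measurability of \<open>V\<close> is needed: \<open>E\<close> is only a
  measurable inner approximation of the violations of \<open>alg\<close>.
\<close>

lemma (in prob_space) ghost_sample_bound:
  fixes N :: nat and \<epsilon> :: real and X :: "'b set" and V :: "'a \<Rightarrow> 'b \<Rightarrow> bool"
    and alg :: "(nat \<Rightarrow> 'a) \<Rightarrow> 'b"
  defines "Q \<equiv> Pi\<^sub>M {..<N} (\<lambda>_. M)"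
  assumes traces: "\<And>z. card ((\<lambda>x. {i\<in>{..<2 * N}. V (z i) x}) ` X) \<le> K"
    and E: "E \<in> sets (Q \<Otimes>\<^sub>M M)" "\<And>\<omega> \<zeta>. (\<omega>, \<zeta>) \<in> E \<Longrightarrow> V \<zeta> (alg \<omega>)"
    and G: "G \<in> sets Q" "\<And>\<omega>. \<omega> \<in> G \<Longrightarrow> alg \<omega> \<in> X"
      "\<And>\<omega> i. \<omega> \<in> G \<Longrightarrow> i < N \<Longrightarrow> \<not> V (\<omega> i) (alg \<omega>)"
      "\<And>\<omega>. \<omega> \<in> G \<Longrightarrow> \<epsilon> \<le> prob (Pair \<omega> -` E)"
    and "0 \<le> \<epsilon>"
  shows "(1 + \<epsilon>) ^ N * measure Q G \<le> K"
proof -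
  define I where "I = {..<N}"
  define J where "J = {N..<2 * N}"
  define R where "R = Pi\<^sub>M {..<2 * N} (\<lambda>_. M)"
  have IJ: "I \<inter> J = {}" "finite I" "finite J" "{..<2 * N} = I \<union> J" "card J = N" "card I = N"
    by (auto simp: I_def J_def)
  interpret P: product_prob_space "\<lambda>_ :: nat. M" ..
  interpret Q: prob_space Q unfolding Q_def by (rule prob_space_PiM) (rule prob_space_axioms)
  interpret R: prob_space R unfolding R_def by (rule prob_space_PiM) (rule prob_space_axioms)
  note [measurable] = E(1) G(1)

  define w :: "(nat \<Rightarrow> 'a) \<Rightarrow> 'a \<Rightarrow> ennreal" where "w \<omega> \<zeta> = 1 + indicator E (\<omega>, \<zeta>)" for \<omega> \<zeta>
  \<comment> \<open>\<open>R\<close> carries both samples, the first on \<open>I\<close> and the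
    ghost on \<open>J\<close>. As \<open>w\<close> is 2 on \<open>E\<close> and 1 elsewhere, the
    product is 2 to the number of ghost entries recorded by \<open>E\<close>.\<close>
  define F where "F z = indicator G (restrict z I) * (\<Prod>i\<in>J. w (restrict z I) (z i))" for z
  have restr [measurable]: "(\<lambda>z. restrict z I) \<in> R \<rightarrow>\<^sub>M Q"
    unfolding R_def Q_def I_def by (rule measurable_restrict_subset) auto
  have w_meas [measurable]: "case_prod w \<in> borel_measurable (Q \<Otimes>\<^sub>M M)"
    unfolding w_def by measurable
  have [measurable]: "(\<lambda>z. w (restrict z I) (z i)) \<in> borel_measurable R" if "i \<in> J" for i
  proof -
    have "(\<lambda>z. (restrict z I, z i)) \<in> R \<rightarrow>\<^sub>M Q \<Otimes>\<^sub>M M"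
      using that by (intro measurable_Pair restr) (auto simp: R_def J_def)
    from measurable_compose[OF this w_meas] show ?thesis by simp
  qed
  have F_meas [measurable]: "F \<in> borel_measurable R"
    unfolding F_def by measurable

  have "ennreal ((1 + \<epsilon>) ^ N) * emeasure Q G = (\<integral>\<^sup>+ \<omega>. ennreal ((1 + \<epsilon>) ^ N) * indicator G \<omega> \<partial>Q)"
    by (simp add: nn_integral_cmult)
  \<comment> \<open>For fixed \<omega> the ghost entries are independent, so the product integrates
    to the \<open>N\<close>-th power of 1 plus the probability of the section of \<open>E\<close>,
    which is at least \<epsilon> on \<open>G\<close>.\<close>
  also have "\<dots> \<le> (\<integral>\<^sup>+ \<omega>. (\<integral>\<^sup>+ \<eta>. F (merge I J (\<omega>, \<eta>)) \<partial>Pi\<^sub>M J (\<lambda>_. M)) \<partial>Q)"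
  proof (rule nn_integral_mono)
    fix \<omega> assume \<omega>: "\<omega> \<in> space Q"
    then have "restrict \<omega> I = \<omega>"
      unfolding Q_def I_def space_PiM by (intro extensional_restrict) (auto simp: PiE_def)
    then have F: "F (merge I J (\<omega>, \<eta>)) = indicator G \<omega> * (\<Prod>i\<in>J. w \<omega> (\<eta> i))" for \<eta>
      unfolding F_def using IJ by simp
    have w\<omega>: "w \<omega> \<in> borel_measurable M"
      using measurable_compose[OF measurable_Pair1'[OF \<omega>] w_meas] by simp
    have sec: "Pair \<omega> -` E \<in> sets M" by (rule sets_Pair1) (rule E(1))
    have "(\<integral>\<^sup>+ \<eta>. F (merge I J (\<omega>, \<eta>)) \<partial>Pi\<^sub>M J (\<lambda>_. M))
        = indicator G \<omega> * (\<integral>\<^sup>+ \<eta>. (\<Prod>i\<in>J. w \<omega> (\<eta> i)) \<partial>Pi\<^sub>M J (\<lambda>_. M))"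
      unfolding F
      by (intro nn_integral_cmult borel_measurable_prod_ennreal measurable_compose[OF _ w\<omega>]
          measurable_component_singleton)
    also have "(\<integral>\<^sup>+ \<eta>. (\<Prod>i\<in>J. w \<omega> (\<eta> i)) \<partial>Pi\<^sub>M J (\<lambda>_. M)) = (\<integral>\<^sup>+ \<zeta>. w \<omega> \<zeta> \<partial>M) ^ N"
      using w\<omega> IJ by (subst P.product_nn_integral_prod) auto
    also have "(\<integral>\<^sup>+ \<zeta>. w \<omega> \<zeta> \<partial>M) = (\<integral>\<^sup>+ \<zeta>. 1 + indicator (Pair \<omega> -` E) \<zeta> \<partial>M)"
      by (simp add: w_def indicator_def)
    also have "\<dots> = ennreal (1 + prob (Pair \<omega> -` E))"
      using sec borel_measurable_indicator[OF sec]
      by (subst nn_integral_add) (auto simp: prob_space emeasure_eq_measure ennreal_plus)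
    finally have eq: "(\<integral>\<^sup>+ \<eta>. F (merge I J (\<omega>, \<eta>)) \<partial>Pi\<^sub>M J (\<lambda>_. M))
        = indicator G \<omega> * ennreal (1 + prob (Pair \<omega> -` E)) ^ N" .
    show "ennreal ((1 + \<epsilon>) ^ N) * indicator G \<omega>
        \<le> (\<integral>\<^sup>+ \<eta>. F (merge I J (\<omega>, \<eta>)) \<partial>Pi\<^sub>M J (\<lambda>_. M))"
    proof (cases "\<omega> \<in> G")
      case True
      then have "(1 + \<epsilon>) ^ N \<le> (1 + prob (Pair \<omega> -` E)) ^ N"
        using G(4) \<open>0 \<le> \<epsilon>\<close> by (intro power_mono) auto
      then show ?thesis unfolding eq using True
        by (simp add: ennreal_power ennreal_leI del: ennreal_plus)
    qed simp
  qed
  also have "\<dots> = (\<integral>\<^sup>+ z. F z \<partial>R)"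
    unfolding R_def Q_def IJ(4) I_def[symmetric]
    by (rule P.product_nn_integral_fold[symmetric]) (use IJ F_meas in \<open>auto simp: R_def\<close>)
  finally have lower: "ennreal ((1 + \<epsilon>) ^ N) * emeasure Q G \<le> (\<integral>\<^sup>+ z. F z \<partial>R)" .

  \<comment> \<open>\<open>\<pi> \<sigma>\<close> exchanges the entries \<open>i\<close> and \<open>i + N\<close> for \<open>i \<in> \<sigma>\<close>.\<close>
  define \<pi> where "\<pi> \<sigma> i = (if i \<in> \<sigma> then i + N else if i \<in> J \<and> i - N \<in> \<sigma> then i - N else i)"
    for \<sigma> and i :: nat
  define \<tau> where "\<tau> \<sigma> z = (\<lambda>i\<in>{..<2 * N}. z (\<pi> \<sigma> i))" for \<sigma> and z :: "nat \<Rightarrow> 'a"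
  have \<pi>: "inj_on (\<pi> \<sigma>) {..<2 * N}" "\<pi> \<sigma> \<in> {..<2 * N} \<rightarrow> {..<2 * N}" if "\<sigma> \<subseteq> I" for \<sigma>
  proof -
    have lt: "i < N" if "i \<in> \<sigma>" for i using that \<open>\<sigma> \<subseteq> I\<close> by (auto simp: I_def)
    have "\<pi> \<sigma> (\<pi> \<sigma> i) = i" for i
      using lt[of i] lt[of "i + N"] lt[of "i - N"] by (auto simp: \<pi>_def J_def)
    then show "inj_on (\<pi> \<sigma>) {..<2 * N}" by (metis inj_on_inverseI)
    show "\<pi> \<sigma> \<in> {..<2 * N} \<rightarrow> {..<2 * N}"
      using lt by (fastforce simp: \<pi>_def J_def)
  qed
  have \<tau>: "\<tau> \<sigma> \<in> R \<rightarrow>\<^sub>M R" "(\<integral>\<^sup>+ z. F z \<partial>R) = (\<integral>\<^sup>+ z. F (\<tau> \<sigma> z) \<partial>R)" if "\<sigma> \<subseteq> I" for \<sigma>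
  proof -
    show meas: "\<tau> \<sigma> \<in> R \<rightarrow>\<^sub>M R"
      unfolding R_def \<tau>_def using \<pi>(2)[OF that]
      by (intro measurable_restrict measurable_component_singleton) auto
    \<comment> \<open>Permuting the coordinates of an i.i.d. sample preserves its law.\<close>
    have inv: "distr R R (\<tau> \<sigma>) = R"
      using distr_PiM_reindex[of "{..<2 * N}" "\<lambda>_. M", OF prob_space_axioms \<pi>[OF that]]
      by (simp add: R_def \<tau>_def[abs_def])
    then show "(\<integral>\<^sup>+ z. F z \<partial>R) = (\<integral>\<^sup>+ z. F (\<tau> \<sigma> z) \<partial>R)"
      using nn_integral_distr[OF meas, of F] F_meas by (simp add: inv)
  qed

  \<comment> \<open>The weight contributed by the pair \<open>i\<close>, \<open>i + N\<close> to the violation pattern \<open>T\<close>: \<open>w0\<close>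
    without and \<open>w1\<close> with the exchange. In all cases \<open>w0 + w1 \<le> 2\<close>.\<close>
  define w0 :: "nat set \<Rightarrow> nat \<Rightarrow> ennreal" where
    "w0 T i = (if i \<in> T then 0 else if i + N \<in> T then 2 else 1)" for T i
  define w1 :: "nat set \<Rightarrow> nat \<Rightarrow> ennreal" where
    "w1 T i = (if i + N \<in> T then 0 else if i \<in> T then 2 else 1)" for T i
  have pointwise: "(\<Sum>\<sigma>\<in>Pow I. F (\<tau> \<sigma> z)) \<le> of_nat K * 2 ^ N" for z
  proof -
    define TR where "TR = (\<lambda>x. {i\<in>{..<2 * N}. V (z i) x}) ` X"
    have fin: "finite TR" by (rule finite_subset[of _ "Pow {..<2 * N}"]) (auto simp: TR_def)
    \<comment> \<open>The decision depends on \<sigma> through the exchanged sample. The summand for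
      its own pattern already bounds \<open>F\<close>; summing over all of \<open>TR\<close> removes
      the dependence.\<close>
    have "F (\<tau> \<sigma> z) \<le> (\<Sum>T\<in>TR. (\<Prod>i\<in>\<sigma>. w1 T i) * (\<Prod>i\<in>I - \<sigma>. w0 T i))" if "\<sigma> \<in> Pow I" for \<sigma>
    proof -
      define \<omega> where "\<omega> = restrict (\<tau> \<sigma> z) I"
      show ?thesis
      proof (cases "\<omega> \<in> G")
        case False
        then show ?thesis by (simp add: F_def \<omega>_def)
      next
        case True
        define x where "x = alg \<omega>"
        define T where "T = {i\<in>{..<2 * N}. V (z i) x}"
        have "T \<in> TR" using G(2)[OF True] by (auto simp: TR_def T_def x_def)
        have w_le: "w \<omega> \<zeta> \<le> (if V \<zeta> x then 2 else 1)" for \<zeta>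
          using E(2)[of \<omega> \<zeta>] by (auto simp: w_def x_def indicator_def)
        have \<tau>1: "\<tau> \<sigma> z i = (if i \<in> \<sigma> then z (i + N) else z i)"
          and \<tau>2: "\<tau> \<sigma> z (i + N) = (if i \<in> \<sigma> then z i else z (i + N))" if "i \<in> I" for i
          using that \<open>\<sigma> \<in> Pow I\<close> by (auto simp: \<tau>_def \<pi>_def I_def J_def subset_eq)
        have notin: "\<not> V (\<tau> \<sigma> z i) x" if "i \<in> I" for i
          using G(3)[OF True, of i] that by (auto simp: \<omega>_def x_def I_def)
        have "F (\<tau> \<sigma> z) = (\<Prod>i\<in>J. w \<omega> (\<tau> \<sigma> z i))"
          using True by (simp add: F_def \<omega>_def)
        also have "\<dots> = (\<Prod>i\<in>I. w \<omega> (\<tau> \<sigma> z (i + N)))"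
          by (rule prod.reindex_bij_witness[of _ "\<lambda>i. i + N" "\<lambda>i. i - N"]) (auto simp: I_def J_def)
        also have "\<dots> \<le> (\<Prod>i\<in>I. if i \<in> \<sigma> then w1 T i else w0 T i)"
        proof (rule prod_mono_ennreal)
          fix i assume i: "i \<in> I"
          show "w \<omega> (\<tau> \<sigma> z (i + N)) \<le> (if i \<in> \<sigma> then w1 T i else w0 T i)"
            using w_le[of "\<tau> \<sigma> z (i + N)"] notin[OF i] i
            by (auto simp: \<tau>1[OF i] \<tau>2[OF i] w0_def w1_def T_def I_def split: if_splits)
        qed
        also have "\<dots> = (\<Prod>i\<in>\<sigma>. w1 T i) * (\<Prod>i\<in>I - \<sigma>. w0 T i)"
          using that IJ by (subst prod.If_cases) (auto intro!: arg_cong2[where f = "(*)"] prod.cong)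
        also have "\<dots> \<le> (\<Sum>T\<in>TR. (\<Prod>i\<in>\<sigma>. w1 T i) * (\<Prod>i\<in>I - \<sigma>. w0 T i))"
          using fin \<open>T \<in> TR\<close> by (intro member_le_sum) auto
        finally show ?thesis .
      qed
    qed
    then have "(\<Sum>\<sigma>\<in>Pow I. F (\<tau> \<sigma> z))
        \<le> (\<Sum>\<sigma>\<in>Pow I. \<Sum>T\<in>TR. (\<Prod>i\<in>\<sigma>. w1 T i) * (\<Prod>i\<in>I - \<sigma>. w0 T i))"
      by (intro sum_mono)
    also have "\<dots> = (\<Sum>T\<in>TR. \<Sum>\<sigma>\<in>Pow I. (\<Prod>i\<in>\<sigma>. w1 T i) * (\<Prod>i\<in>I - \<sigma>. w0 T i))"
      by (rule sum.swap)
    \<comment> \<open>The sum over all exchanges is the expansion of a product of sums, one product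
      per pattern.\<close>
    also have "\<dots> = (\<Sum>T\<in>TR. \<Prod>i\<in>I. w1 T i + w0 T i)"
      using IJ by (simp add: prod_add)
    also have "\<dots> \<le> (\<Sum>T\<in>TR. \<Prod>i\<in>I. 2)"
      by (intro sum_mono prod_mono_ennreal) (auto simp: w0_def w1_def)
    also have "\<dots> = of_nat (card TR) * 2 ^ N" using IJ by simp
    also have "\<dots> \<le> of_nat K * 2 ^ N"
      using traces[of z] by (intro mult_right_mono) (auto simp: TR_def)
    finally show ?thesis .
  qed
  \<comment> \<open>All \<open>2 ^ N\<close> exchanges give the same integral, so the pointwise
    bound on their sum bounds the integral of \<open>F\<close> by \<open>K\<close>.\<close>
  have "2 ^ N * (\<integral>\<^sup>+ z. F z \<partial>R) = (\<Sum>\<sigma>\<in>Pow I. \<integral>\<^sup>+ z. F z \<partial>R)"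
    using IJ by (simp add: card_Pow)
  also have "\<dots> = (\<Sum>\<sigma>\<in>Pow I. \<integral>\<^sup>+ z. F (\<tau> \<sigma> z) \<partial>R)"
    using \<tau>(2) by (intro sum.cong) auto
  also have "\<dots> = (\<integral>\<^sup>+ z. (\<Sum>\<sigma>\<in>Pow I. F (\<tau> \<sigma> z)) \<partial>R)"
    by (intro nn_integral_sum[symmetric] measurable_compose[OF \<tau>(1) F_meas]) auto
  also have "\<dots> \<le> (\<integral>\<^sup>+ z. of_nat K * 2 ^ N \<partial>R)"
    by (intro nn_integral_mono pointwise)
  also have "\<dots> = 2 ^ N * of_nat K"
    by (simp add: R.emeasure_space_1 mult.commute)
  finally have upper: "2 ^ N * (\<integral>\<^sup>+ z. F z \<partial>R) \<le> 2 ^ N * of_nat K" .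
  have "(2 :: ennreal) ^ N = ennreal (2 ^ N)" by (simp flip: ennreal_power)
  then have "2 ^ N * (ennreal ((1 + \<epsilon>) ^ N) * emeasure Q G) \<le> 2 ^ N * of_nat K"
    using mult_left_mono[OF lower, of "2 ^ N"] upper by (meson order_trans zero_le)
  also have "2 ^ N * (ennreal ((1 + \<epsilon>) ^ N) * emeasure Q G)
      = ennreal (2 ^ N * ((1 + \<epsilon>) ^ N * measure Q G))"
    using \<open>0 \<le> \<epsilon>\<close> \<open>(2 :: ennreal) ^ N = _\<close>
    by (simp add: Q.emeasure_eq_measure ennreal_mult)
  also have "2 ^ N * of_nat K = ennreal (2 ^ N * real K)"
    using \<open>(2 :: ennreal) ^ N = _\<close> by (simp add: ennreal_mult ennreal_of_nat_eq_real_of_nat)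
  finally have "2 ^ N * ((1 + \<epsilon>) ^ N * measure Q G) \<le> 2 ^ N * real K"
    by (simp add: ennreal_le_iff)
  then show ?thesis by simp
qed

section \<open>The tail of the violation probability\<close>

text \<open>Coordinatewise from the real-valued case, uniting finitely many null sets. It will
  provide a Borel version of \<open>xstar\<close>.\<close>

lemma completion_ex_borel_measurable_euclidean:
  fixes g :: "'a \<Rightarrow> 'b::euclidean_space"
  assumes "g \<in> borel_measurable (completion M)"
  obtains g' where "g' \<in> borel_measurable M" "AE x in M. g x = g' x"
proof -
  have "\<exists>h\<in>borel_measurable M. AE x in M. g x \<bullet> b = h x" for b
    by (rule completion_ex_borel_measurable_real) (use assms in measurable)
  then obtain h where h: "\<And>b. h b \<in> borel_measurable M" "\<And>b. AE x in M. g x \<bullet> b = h b x"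
    by metis
  show thesis
  proof
    show "(\<lambda>x. \<Sum>b\<in>Basis. h b x *\<^sub>R b) \<in> borel_measurable M"
      using h(1) by measurable
    have "AE x in M. \<forall>b\<in>Basis. g x \<bullet> b = h b x"
      by (rule AE_finite_allI) (use h(2) in auto)
    then show "AE x in M. g x = (\<Sum>b\<in>Basis. h b x *\<^sub>R b)"
    proof eventually_elim
      case (elim x)
      then have "(\<Sum>b\<in>Basis. h b x *\<^sub>R b) = (\<Sum>b\<in>Basis. (g x \<bullet> b) *\<^sub>R b)"
        by (intro sum.cong) auto
      then show ?case by (simp add: euclidean_representation)
    qed
  qed
qed

text \<open>As \<open>M\<close> is complete, preimages of subsets of null sets of the law are
  measurable, so \<xi> stays measurable into the completed law.\<close>

lemma
  assumes "complete_measure M" "\<xi> \<in> M \<rightarrow>\<^sub>M restrict_space borel \<Xi>"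
  shows measurable_law: "\<xi> \<in> M \<rightarrow>\<^sub>M law M \<Xi> \<xi>"
    and distr_law: "distr M (law M \<Xi> \<xi>) \<xi> = law M \<Xi> \<xi>"
    and space_law: "space (law M \<Xi> \<xi>) = \<Xi>"
proof -
  interpret complete_measure M by fact
  define D where "D = distr M (restrict_space borel \<Xi>) \<xi>"
  have \<xi>D: "\<xi> \<in> M \<rightarrow>\<^sub>M D" using assms(2) by (simp add: D_def)
  have DD: "distr M D \<xi> = D" unfolding D_def by (intro distr_cong) auto
  show "\<xi> \<in> M \<rightarrow>\<^sub>M law M \<Xi> \<xi>"
    unfolding law_def D_def[symmetric] by (rule measurable_completion2[OF \<xi>D]) (simp add: DD)
  show "distr M (law M \<Xi> \<xi>) \<xi> = law M \<Xi> \<xi>"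
    using completion_distr_eq[OF \<xi>D] by (simp add: DD law_def flip: D_def)
  show "space (law M \<Xi> \<xi>) = \<Xi>"
    by (simp add: law_def space_restrict_space)
qed

lemma violation_eq_prob:
  assumes "complete_measure M" "\<xi> \<in> M \<rightarrow>\<^sub>M restrict_space borel \<Xi>"
    and "{\<zeta> \<in> \<Xi>. f \<zeta> x = \<infinity>} \<in> sets (law M \<Xi> \<xi>)"
  shows "violation (law M \<Xi> \<xi>) f x = measure M {\<omega> \<in> space M. f (\<xi> \<omega>) x = \<infinity>}"
    and "{\<omega> \<in> space M. f (\<xi> \<omega>) x = \<infinity>} \<in> sets M"
proof -
  note P = measurable_law[OF assms(1,2)] distr_law[OF assms(1,2)] space_law[OF assms(1,2)]
  have eq: "\<xi> -` {\<zeta> \<in> \<Xi>. f \<zeta> x = \<infinity>} \<inter> space M = {\<omega> \<in> space M. f (\<xi> \<omega>) x = \<infinity>}"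
    using measurable_space[OF P(1)] P(3) by auto
  show "violation (law M \<Xi> \<xi>) f x = measure M {\<omega> \<in> space M. f (\<xi> \<omega>) x = \<infinity>}"
    unfolding violation_def P(3) using measure_distr[OF P(1) assms(3)] eq P(2) by metis
  show "{\<omega> \<in> space M. f (\<xi> \<omega>) x = \<infinity>} \<in> sets M"
    using measurable_sets[OF P(1) assms(3)] eq by simp
qed

text \<open>If the value were infinite with positive probability, the positive part would have
  infinite integral, and \<open>\<infinity> - \<infinity> = \<infinity>\<close> would leave the
  objective infinite. This yields a decision feasible for almost every sample.\<close>

lemma objective_finite_AE:
  assumes "{\<omega> \<in> space M. f (\<xi> \<omega>) x = \<infinity>} \<in> sets M" "objective M \<xi> f0 f x < \<infinity>"
  shows "AE \<omega> in M. f (\<xi> \<omega>) x < \<infinity>"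
proof -
  define Z where "Z = {\<omega> \<in> space M. f (\<xi> \<omega>) x = \<infinity>}"
  have Z: "Z \<in> sets M" using assms(1) by (simp add: Z_def)
  have fin: "(\<integral>\<^sup>+ \<omega>. e2ennreal (f (\<xi> \<omega>) x) \<partial>M) < \<infinity>"
  proof (rule ccontr)
    assume "\<not> ?thesis"
    then have "(\<integral>\<^sup>+ \<omega>. e2ennreal (f (\<xi> \<omega>) x) \<partial>M) = \<infinity>"
      by (metis infinity_ennreal_def less_top)
    then show False
      using assms(2) by (simp add: objective_def ereal_expectation_def)
  qed
  have "(\<infinity> :: ennreal) * emeasure M Z = (\<integral>\<^sup>+ \<omega>. \<infinity> * indicator Z \<omega> \<partial>M)"
    using Z by (simp add: nn_integral_cmult)
  also have "\<dots> \<le> (\<integral>\<^sup>+ \<omega>. e2ennreal (f (\<xi> \<omega>) x) \<partial>M)"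
    by (intro nn_integral_mono) (auto simp: Z_def indicator_def)
  finally have "(\<infinity> :: ennreal) * emeasure M Z < \<infinity>" using fin by (rule order.strict_trans1)
  then have "emeasure M Z = 0" by (auto simp: ennreal_mult_eq_top_iff less_top[symmetric])
  then have "Z \<in> null_sets M" using Z by auto
  then have "AE \<omega> in M. \<omega> \<notin> Z" by (rule AE_not_in)
  with AE_space show ?thesis by eventually_elim (auto simp: Z_def)
qed

text \<open>Transfers \<open>ghost_sample_bound\<close> to the sampled scenarios.
  \<open>good\<close> is an almost sure property to which the counting of patterns is
  restricted.\<close>

lemma violation_tail_bound:
  fixes M :: "'a measure" and \<Xi> :: "'c::topological_space set" and \<xi> :: "'a \<Rightarrow> 'c"
    and X :: "'b::euclidean_space set" and xstar :: "(nat \<Rightarrow> 'c) \<Rightarrow> 'b" and \<epsilon> :: real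
  defines "P \<equiv> law M \<Xi> \<xi>"
  assumes "prob_space M" "complete_measure M" "\<xi> \<in> M \<rightarrow>\<^sub>M restrict_space borel \<Xi>"
    and "closed X" "x0 \<in> X" "AE \<omega> in M. f (\<xi> \<omega>) x0 < \<infinity>"
    and good: "AE \<zeta> in P. good \<zeta>"
    and joint: "jointly_measurable M X (\<lambda>\<omega> x. f (\<xi> \<omega>) x)"
    and feas: "\<And>s. s \<in> space (sample_law N P) \<Longrightarrow> saa_feasible N X f s \<noteq> {} \<Longrightarrow>
      xstar s \<in> saa_feasible N X f s"
    and viol: "\<And>x. x \<in> X \<Longrightarrow> {\<zeta> \<in> \<Xi>. f \<zeta> x = \<infinity>} \<in> sets P"
    and xstar: "xstar \<in> borel_measurable (sample_law N P)"
    and meas: "(\<lambda>s. violation P f (xstar s)) \<in> borel_measurable (sample_law N P)"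
    and traces: "\<And>z. card ((\<lambda>x. {i\<in>{..<2 * N}.
      \<xi> (z i) \<in> \<Xi> \<and> good (\<xi> (z i)) \<and> f (\<xi> (z i)) x = \<infinity>}) ` X) \<le> K"
    and "0 \<le> \<epsilon>"
  shows "(1 + \<epsilon>) ^ N * measure (sample_law N P)
    {s \<in> space (sample_law N P). violation P f (xstar s) > \<epsilon>} \<le> K"
proof -
  interpret M: prob_space M by fact
  interpret C: complete_measure M by fact
  note \<xi>P = measurable_law[OF assms(3,4), folded P_def]
    and distrP = distr_law[OF assms(3,4), folded P_def]
    and spaceP = space_law[OF assms(3,4), folded P_def]
  interpret P: prob_space P
    using M.prob_space_distr[OF \<xi>P] by (simp add: distrP)

  define Q where "Q = Pi\<^sub>M {..<N} (\<lambda>_. M)"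
  define S where "S = Pi\<^sub>M {..<N} (\<lambda>_. P)"
  \<comment> \<open>Joint measurability is assumed over \<open>M\<close>, so the argument runs on
    samples of outcomes, and \<Phi> carries the result over to scenarios.\<close>
  define \<Phi> where "\<Phi> = (compose {..<N} \<xi> :: (nat \<Rightarrow> 'a) \<Rightarrow> _)"
  have sample: "sample_law N P = completion S" by (simp add: sample_law_def S_def)
  interpret Q: prob_space Q unfolding Q_def by (rule prob_space_PiM) (rule M.prob_space_axioms)
  interpret S: prob_space S unfolding S_def by (rule prob_space_PiM) (rule P.prob_space_axioms)
  have \<Phi>_meas [measurable]: "\<Phi> \<in> Q \<rightarrow>\<^sub>M S"
    unfolding \<Phi>_def Q_def S_def compose_def
    by (intro measurable_restrict measurable_compose[OF _ \<xi>P] measurable_component_singleton)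
  have \<Phi>_distr: "distr Q S \<Phi> = S"
    unfolding \<Phi>_def Q_def S_def
    using distr_PiM_finite_prob_space'[of "{..<N}" "\<lambda>_. M" "\<lambda>_. P" \<xi>]
      M.prob_space_axioms P.prob_space_axioms \<xi>P by (simp add: distrP)

  obtain x1 where x1 [measurable]: "x1 \<in> borel_measurable S" and x1_eq: "AE s in S. xstar s = x1 s"
    using completion_ex_borel_measurable_euclidean xstar unfolding sample by metis
  \<comment> \<open>The default \<open>x0\<close> makes \<open>alg\<close> take values in
    \<open>X\<close> everywhere, so that its law is among the measures in
    \<open>jointly_measurable\<close>.\<close>
  define alg where "alg \<omega> = (if x1 (\<Phi> \<omega>) \<in> X then x1 (\<Phi> \<omega>) else x0)" for \<omega>
  have [measurable]: "X \<in> sets borel" using \<open>closed X\<close> by (rule borel_closed)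
  have alg_meas: "alg \<in> Q \<rightarrow>\<^sub>M restrict_space borel X"
  proof (rule measurable_restrict_space2)
    show "alg \<in> space Q \<rightarrow> X" using \<open>x0 \<in> X\<close> by (auto simp: alg_def)
    show "alg \<in> Q \<rightarrow>\<^sub>M borel" unfolding alg_def by measurable
  qed
  define \<mu> where "\<mu> = distr Q (restrict_space borel X) alg"
  have alg_\<mu>: "alg \<in> Q \<rightarrow>\<^sub>M \<mu>" using alg_meas by (simp add: \<mu>_def)
  have sets_\<mu>: "sets \<mu> = sets (restrict_space borel X)" by (simp add: \<mu>_def)
  interpret \<mu>: prob_space \<mu> unfolding \<mu>_def by (rule Q.prob_space_distr[OF alg_meas])
  interpret M\<mu>: pair_prob_space M \<mu> ..
  have space_\<mu>: "space \<mu> = X" by (simp add: \<mu>_def space_restrict_space)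

  define U where "U = {(\<omega>, x) \<in> space (M \<Otimes>\<^sub>M \<mu>). f (\<xi> \<omega>) x = \<infinity>}"
  have "(\<lambda>(\<omega>, x). f (\<xi> \<omega>) x) \<in> borel_measurable (completion (M \<Otimes>\<^sub>M \<mu>))"
    using joint \<mu>.prob_space_axioms sets_\<mu> unfolding jointly_measurable_def by blast
  then have "(\<lambda>(\<omega>, x). f (\<xi> \<omega>) x) -` {\<infinity>} \<inter> space (completion (M \<Otimes>\<^sub>M \<mu>)) \<in> sets (completion (M \<Otimes>\<^sub>M \<mu>))"
    by (rule measurable_sets) simp
  also have "(\<lambda>(\<omega>, x). f (\<xi> \<omega>) x) -` {\<infinity>} \<inter> space (completion (M \<Otimes>\<^sub>M \<mu>)) = U"
    by (auto simp: U_def)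
  \<comment> \<open>\<open>U\<close> is measurable only for the completion: \<open>B\<close> is its
    part in the product \<sigma>-algebra, and the rest lies in the null set
    \<open>N2\<close>.\<close>
  finally obtain B N1 N2 where B: "U = B \<union> N1" "N1 \<subseteq> N2" "N2 \<in> null_sets (M \<Otimes>\<^sub>M \<mu>)"
    "B \<in> sets (M \<Otimes>\<^sub>M \<mu>)"
    by (rule sets_completionE)

  have "AE \<zeta> in distr M P \<xi>. good \<zeta>" unfolding distrP by (rule good)
  then have "AE \<omega> in M. good (\<xi> \<omega>)" by (rule AE_distrD[OF \<xi>P])
  then obtain Nb where Nb: "{\<omega> \<in> space M. \<not> good (\<xi> \<omega>)} \<subseteq> Nb" "Nb \<in> null_sets M"
    by (auto elim!: AE_E simp: null_sets_def)

  define V where "V \<omega> x \<longleftrightarrow> \<xi> \<omega> \<in> \<Xi> \<and> good (\<xi> \<omega>) \<and> f (\<xi> \<omega>) x = \<infinity>" for \<omega> x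
  \<comment> \<open>The joint measurability assumption, used for the law \<open>\<mu>\<close> of \<open>alg\<close>, leaves only a null set
    outside \<open>B\<close>.\<close>
  define E where "E = (\<lambda>(\<omega>, \<zeta>). (\<zeta>, alg \<omega>)) -` (B - Nb \<times> space \<mu>) \<inter> space (Q \<Otimes>\<^sub>M M)"
  have E_meas: "E \<in> sets (Q \<Otimes>\<^sub>M M)"
  proof -
    have "(\<lambda>p. (snd p, alg (fst p))) \<in> Q \<Otimes>\<^sub>M M \<rightarrow>\<^sub>M M \<Otimes>\<^sub>M \<mu>"
      by (intro measurable_Pair measurable_snd measurable_compose[OF measurable_fst alg_\<mu>])
    then have "(\<lambda>(\<omega>, \<zeta>). (\<zeta>, alg \<omega>)) \<in> Q \<Otimes>\<^sub>M M \<rightarrow>\<^sub>M M \<Otimes>\<^sub>M \<mu>"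
      by (simp add: case_prod_unfold)
    moreover have "B - Nb \<times> space \<mu> \<in> sets (M \<Otimes>\<^sub>M \<mu>)"
      using B(4) Nb(2) by auto
    ultimately show ?thesis unfolding E_def by (rule measurable_sets)
  qed
  have E_V: "V \<zeta> (alg \<omega>)" if "(\<omega>, \<zeta>) \<in> E" for \<omega> \<zeta>
  proof -
    have z: "\<zeta> \<in> space M" "(\<zeta>, alg \<omega>) \<in> B" "\<omega> \<in> space Q" "\<not> (\<zeta> \<in> Nb \<and> alg \<omega> \<in> space \<mu>)"
      using that by (auto simp: E_def space_pair_measure)
    then have "(\<zeta>, alg \<omega>) \<in> U" using B(1) by blast
    moreover have "\<zeta> \<notin> Nb" using z measurable_space[OF alg_\<mu>] by blast
    ultimately show ?thesis
      using Nb(1) z(1) measurable_space[OF \<xi>P z(1)] spaceP by (auto simp: V_def U_def)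
  qed

  have sec: "AE \<omega> in Q. violation P f (alg \<omega>) \<le> M.prob (Pair \<omega> -` E)"
  proof -
    have N2: "N2 \<in> sets (M \<Otimes>\<^sub>M \<mu>)" using B(3) by auto
    \<comment> \<open>By Fubini almost every section of \<open>N2\<close> is null; since \<mu> is
      the law of \<open>alg\<close>, this covers the section at \<open>alg \<omega>\<close> for
      almost every \<omega>.\<close>
    have "(\<integral>\<^sup>+ x. emeasure M ((\<lambda>\<omega>. (\<omega>, x)) -` N2) \<partial>\<mu>) = 0"
      using M\<mu>.emeasure_pair_measure_alt2[OF N2] B(3) by auto
    moreover have "(\<lambda>x. emeasure M ((\<lambda>\<omega>. (\<omega>, x)) -` N2)) \<in> borel_measurable \<mu>"
      by (rule M\<mu>.measurable_emeasure_Pair2[OF N2])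
    ultimately have "AE x in \<mu>. emeasure M ((\<lambda>\<omega>. (\<omega>, x)) -` N2) = 0"
      by (simp add: nn_integral_0_iff_AE)
    then have "AE \<omega> in Q. emeasure M ((\<lambda>\<zeta>. (\<zeta>, alg \<omega>)) -` N2) = 0"
      unfolding \<mu>_def by (rule AE_distrD[OF alg_meas])
    with AE_space show ?thesis
    proof eventually_elim
      case (elim \<omega>)
      let ?N = "(\<lambda>\<zeta>. (\<zeta>, alg \<omega>)) -` N2"
      have X: "alg \<omega> \<in> X" using measurable_space[OF alg_\<mu>] elim(1) space_\<mu> by auto
      have N: "?N \<in> null_sets M"
        using elim(2) sets_Pair2[OF N2] by auto
      have P: "Pair \<omega> -` E \<in> sets M" by (rule sets_Pair1[OF E_meas])
      note viol' = violation_eq_prob[where f = f and x = "alg \<omega>", OF assms(3,4) viol[OF X, unfolded P_def]]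
      have "{\<zeta> \<in> space M. f (\<xi> \<zeta>) (alg \<omega>) = \<infinity>} \<subseteq> Pair \<omega> -` E \<union> (?N \<union> Nb)"
      proof
        fix \<zeta> assume "\<zeta> \<in> {\<zeta> \<in> space M. f (\<xi> \<zeta>) (alg \<omega>) = \<infinity>}"
        then have z: "\<zeta> \<in> space M" "(\<zeta>, alg \<omega>) \<in> U"
          using X by (auto simp: U_def space_pair_measure space_\<mu>)
        then show "\<zeta> \<in> Pair \<omega> -` E \<union> (?N \<union> Nb)"
          using B(1,2) elim(1) by (auto simp: E_def space_pair_measure)
      qed
      then have "M.prob {\<zeta> \<in> space M. f (\<xi> \<zeta>) (alg \<omega>) = \<infinity>} \<le> M.prob (Pair \<omega> -` E \<union> (?N \<union> Nb))"
        using P N Nb(2) by (intro M.finite_measure_mono) auto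
      also have "\<dots> = M.prob (Pair \<omega> -` E)"
        using P N Nb(2) by (intro measure_Un_null_set) auto
      finally show ?case unfolding P_def viol'(1) .
    qed
  qed

  \<comment> \<open>Almost surely \<open>x0\<close> is feasible for all sampled scenarios, so the
    guarantee on \<open>xstar\<close> applies. It places \<open>xstar\<close> in \<open>X\<close>,
    where \<open>alg\<close> does not fall back on its default.\<close>
  have alg_eq: "AE \<omega> in Q. alg \<omega> = xstar (\<Phi> \<omega>) \<and> xstar (\<Phi> \<omega>) \<in> saa_feasible N X f (\<Phi> \<omega>)"
  proof -
    have "AE \<omega> in Q. xstar (\<Phi> \<omega>) = x1 (\<Phi> \<omega>)"
      by (rule AE_distrD[OF \<Phi>_meas]) (use x1_eq in \<open>simp only: \<Phi>_distr\<close>)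
    moreover have "AE \<omega> in Q. \<forall>i\<in>{..<N}. f (\<xi> (\<omega> i)) x0 < \<infinity>"
      unfolding Q_def
      by (intro AE_finite_allI AE_PiM_component) (use assms(7) M.prob_space_axioms in auto)
    ultimately show ?thesis
      using AE_space
    proof eventually_elim
      case (elim \<omega>)
      have "\<Phi> \<omega> \<in> space (sample_law N P)"
        using measurable_space[OF \<Phi>_meas elim(3)] by (simp add: sample)
      moreover have "x0 \<in> saa_feasible N X f (\<Phi> \<omega>)"
        using elim(2) \<open>x0 \<in> X\<close> by (auto simp: saa_feasible_def \<Phi>_def compose_def)
      ultimately have "xstar (\<Phi> \<omega>) \<in> saa_feasible N X f (\<Phi> \<omega>)" using feas by blast
      then show ?case using elim(1) by (auto simp: alg_def saa_feasible_def)
    qed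
  qed
  from sec alg_eq have "AE \<omega> in Q. violation P f (xstar (\<Phi> \<omega>)) \<le> M.prob (Pair \<omega> -` E) \<and>
      alg \<omega> \<in> saa_feasible N X f (\<Phi> \<omega>)"
    by eventually_elim auto
  then obtain Nq where Nq0: "Nq \<in> null_sets Q"
    "\<And>\<omega>. \<omega> \<in> space Q - Nq \<Longrightarrow> violation P f (xstar (\<Phi> \<omega>)) \<le> M.prob (Pair \<omega> -` E) \<and>
      alg \<omega> \<in> saa_feasible N X f (\<Phi> \<omega>)"
    by (rule AE_E3) blast
  note Nq = Nq0(1) Nq0(2)[THEN conjunct1] Nq0(2)[THEN conjunct2]

  \<comment> \<open>Sections of \<open>E\<close> replace the violation probability, which makes
    \<open>G\<close> measurable. Up to \<open>Nq\<close> it still contains every sample whose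
    violation probability exceeds \<epsilon>.\<close>
  define G where "G = {\<omega> \<in> space Q. ennreal \<epsilon> \<le> emeasure M (Pair \<omega> -` E)} - Nq"
  have G_meas: "G \<in> sets Q"
    unfolding G_def using Nq(1) M.measurable_emeasure_Pair[OF E_meas] by auto
  have "(1 + \<epsilon>) ^ N * measure Q G \<le> K"
    unfolding Q_def
  proof (rule M.ghost_sample_bound[where V = V and alg = alg and E = E and X = X])
    show "card ((\<lambda>x. {i \<in> {..<2 * N}. V (z i) x}) ` X) \<le> K" for z
      using traces[of z] by (simp add: V_def)
    show "E \<in> sets (Pi\<^sub>M {..<N} (\<lambda>_. M) \<Otimes>\<^sub>M M)" "G \<in> sets (Pi\<^sub>M {..<N} (\<lambda>_. M))"
      using E_meas G_meas by (simp_all add: Q_def)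
    show "V \<zeta> (alg \<omega>)" if "(\<omega>, \<zeta>) \<in> E" for \<omega> \<zeta> using that by (rule E_V)
  next
    fix \<omega> assume "\<omega> \<in> G"
    then have \<omega>: "\<omega> \<in> space Q - Nq" "ennreal \<epsilon> \<le> emeasure M (Pair \<omega> -` E)"
      by (auto simp: G_def)
    show "alg \<omega> \<in> X" using Nq(3)[OF \<omega>(1)] by (simp add: saa_feasible_def)
    show "\<not> V (\<omega> i) (alg \<omega>)" if "i < N" for i
      using Nq(3)[OF \<omega>(1)] that by (auto simp: saa_feasible_def V_def \<Phi>_def compose_def)
    show "\<epsilon> \<le> M.prob (Pair \<omega> -` E)" using \<omega>(2) \<open>0 \<le> \<epsilon>\<close> by (simp add: M.emeasure_eq_measure)
  qed (rule \<open>0 \<le> \<epsilon>\<close>)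
  moreover have "measure (sample_law N P) {s \<in> space (sample_law N P). violation P f (xstar s) > \<epsilon>}
      \<le> measure Q G"
  proof -
    define H where "H = {s \<in> space (sample_law N P). violation P f (xstar s) > \<epsilon>}"
    have H: "H \<in> sets (completion S)" 
      unfolding H_def sample[symmetric] by (rule borel_measurable_less[OF borel_measurable_const meas])
    \<comment> \<open>\<open>H\<close> is measurable only for the completed sample law. Its main
      part has the same measure and lies in the uncompleted product, so it can be pulled back along
      \<Phi>.\<close>
    define H0 where "H0 = main_part S H"
    have H0: "H0 \<in> sets S" "H0 \<subseteq> H"
      unfolding H0_def using main_part_sets[OF H] main_part_null_part_Un[OF H] by auto
    have "measure (sample_law N P) H = measure S H0"
      unfolding sample measure_def H0_def using H by simp
    also have "\<dots> = measure Q (\<Phi> -` H0 \<inter> space Q)"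
      using measure_distr[OF \<Phi>_meas H0(1)] by (simp add: \<Phi>_distr)
    also have "\<dots> \<le> measure Q (G \<union> Nq)"
    proof (rule Q.finite_measure_mono)
      show "\<Phi> -` H0 \<inter> space Q \<subseteq> G \<union> Nq"
      proof
        fix \<omega> assume \<omega>: "\<omega> \<in> \<Phi> -` H0 \<inter> space Q"
        then have "\<epsilon> < violation P f (xstar (\<Phi> \<omega>))" using H0(2) by (auto simp: H_def)
        then show "\<omega> \<in> G \<union> Nq"
          using \<omega> Nq(2)[of \<omega>] by (auto simp: G_def M.emeasure_eq_measure intro!: ennreal_leI)
      qed
      show "G \<union> Nq \<in> sets Q" using G_meas Nq(1) by auto
    qed
    also have "\<dots> = measure Q G" using G_meas Nq(1) by (intro measure_Un_null_set)
    finally show ?thesis by (simp add: H_def)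
  qed
  ultimately show ?thesis
    using \<open>0 \<le> \<epsilon>\<close> by (meson mult_left_mono order_trans zero_le_power add_nonneg_nonneg zero_le_one)
qed

section \<open>Numerical estimates\<close>

text \<open>From \<open>exp y \<le> 1 + y + y^2\<close> at \<open>y = x / 2\<close>.\<close>

lemma exp_half_le_one_plus:
  fixes x :: real
  assumes "0 \<le> x" "x \<le> 1"
  shows "exp (x / 2) \<le> 1 + x"
  using exp_bound[of "x / 2"] assms
  by (simp add: power2_eq_square) (use mult_left_le[of x x] in linarith)

text \<open>The binomial is at most \<open>u ^ k\<close>, so after taking \<open>k\<close>-th roots
  it suffices to bound \<open>8 / \<epsilon> * j * u\<close> by \<open>12 / \<epsilon>\<close> to
  the power \<open>A\<close>, which is \<open>d_VC\<close> divided by \<open>k\<close>. The exponent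
  is shared out as 1 for \<open>8 / \<epsilon>\<close>, \<open>j\<close> for the factor
  \<open>j\<close> and \<open>L\<close> for \<open>u = 2 powr L\<close>.\<close>

lemma d_VC_power_bound:
  fixes \<epsilon> :: real
  assumes "n0 \<le> n" "1 \<le> j" "0 < \<epsilon>" "\<epsilon> < 1"
  shows "real (n choose n0) * (8 * real j / \<epsilon>) ^ (n0 + 1) \<le> (12 / \<epsilon>) powr d_VC n n0 j"
proof -
  define k where "k = n0 + 1"
  define u where "u = (real n * exp 1 + exp 1) / (real n0 + 1)"
  define L where "L = log 2 u"
  define c where "c = exp 1 / ((exp 1 - 1) * ln 2 :: real)"
  define A where "A = c * real j * (2 * L) * ln (exp 1 / ln 2 * real j)"
  have e: "2 < exp (1::real)" "exp (1::real) \<le> 3"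
    using exp_ge_one_plus_x_over_n_power_n[of 2 1] exp_le by (auto simp: power2_eq_square)
  have u_eq: "u = real (n + 1) * exp 1 / real k"
    by (simp add: u_def k_def algebra_simps)
  have "exp 1 * real k \<le> exp 1 * real (n + 1)" using assms(1) by (simp add: k_def)
  then have u: "exp 1 \<le> u" unfolding u_eq by (simp add: k_def field_simps)
  then have "0 < u" "2 \<le> u" using e by linarith+
  have L: "1 \<le> L" "u = 2 powr L"
    using \<open>2 \<le> u\<close> by (auto simp: L_def le_log_iff)
  have ln2: "0 < ln (2::real)" "ln (2::real) \<le> 1"
    using ln_le_minus_one[of "2::real"] by auto
  have "3 / 2 \<le> exp 1 / (exp 1 - 1 :: real)" using e by (simp add: field_simps)
  also have "\<dots> \<le> c"
    unfolding c_def using e ln2 by (intro divide_left_mono) (auto simp: mult_left_le)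
  finally have c: "3 / 2 \<le> c" .
  have "exp 1 * ln 2 \<le> exp 1 * real j" using assms(2) ln2 by simp
  then have "exp 1 \<le> exp 1 / ln 2 * real j" using ln2 by (simp add: field_simps)
  then have "1 \<le> ln (exp 1 / ln 2 * real j)"
    by (metis exp_gt_zero ln_exp ln_mono order_less_le_trans)
  moreover have "3 / 2 * (real j * (2 * L)) \<le> c * (real j * (2 * L))"
    using c L by (intro mult_right_mono) auto
  ultimately have "3 / 2 * (real j * (2 * L)) * 1 \<le> c * (real j * (2 * L)) * ln (exp 1 / ln 2 * real j)"
    using c L by (intro mult_mono[of "3 / 2 * (real j * (2 * L))"]) auto
  then have "3 / 2 * (real j * (2 * L)) \<le> A" by (simp add: A_def mult.assoc)
  \<comment> \<open>As \<open>j\<close> and \<open>L\<close> are at least 1, each of 1,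
    \<open>j\<close> and \<open>L\<close> is at most \<open>j * L\<close>; the lower bound on
    \<open>A\<close> is three times that.\<close>
  moreover have "real j \<le> real j * L" "L \<le> real j * L"
    using assms(2) L by auto
  moreover have "3 / 2 * (real j * (2 * L)) = 3 * (real j * L)" "1 \<le> real j"
    using assms(2) by simp_all
  ultimately have A: "1 + real j + L \<le> A" by linarith
  have "12 / \<epsilon> \<ge> 12" using assms by (simp add: field_simps)
  have "8 / \<epsilon> \<le> (12 / \<epsilon>) powr 1" using assms by (simp add: field_simps)
  moreover have "real j \<le> (12 / \<epsilon>) powr real j"
  proof -
    have "real j \<le> 2 ^ j" by (simp add: of_nat_less_two_power less_imp_le)
    also have "\<dots> \<le> (12 / \<epsilon>) ^ j" using \<open>12 / \<epsilon> \<ge> 12\<close> by (intro power_mono) auto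
    finally show ?thesis using assms by (simp add: powr_realpow)
  qed
  moreover have "u \<le> (12 / \<epsilon>) powr L"
    unfolding L(2) using \<open>12 / \<epsilon> \<ge> 12\<close> L(1) by (intro powr_mono2) auto
  ultimately have "8 / \<epsilon> * real j * u \<le> (12 / \<epsilon>) powr 1 * (12 / \<epsilon>) powr real j * (12 / \<epsilon>) powr L"
    using assms \<open>0 < u\<close> by (intro mult_mono) auto
  also have "\<dots> = (12 / \<epsilon>) powr (1 + real j + L)" by (simp only: powr_add)
  also have "\<dots> \<le> (12 / \<epsilon>) powr A"
    using \<open>12 / \<epsilon> \<ge> 12\<close> A by (intro powr_mono) auto
  finally have step: "8 / \<epsilon> * real j * u \<le> (12 / \<epsilon>) powr A" .
  \<comment> \<open>Pascal's rule. Raising both arguments by one produces the base \<open>u\<close>,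
    the argument of the logarithm in \<open>d_VC\<close>.\<close>
  have "real (n choose n0) \<le> real ((n + 1) choose k)" by (simp add: k_def)
  also have "\<dots> \<le> u ^ k"
    unfolding u_eq using assms(1) by (intro choose_le_exp_power) (auto simp: k_def)
  finally have "real (n choose n0) * (8 * real j / \<epsilon>) ^ k \<le> u ^ k * (8 * real j / \<epsilon>) ^ k"
    using assms by (intro mult_right_mono) auto
  also have "\<dots> = (8 / \<epsilon> * real j * u) ^ k"
    by (simp add: power_mult_distrib[symmetric] mult_ac)
  also have "\<dots> \<le> ((12 / \<epsilon>) powr A) ^ k"
    using step assms \<open>0 < u\<close> by (intro power_mono) auto
  also have "\<dots> = (12 / \<epsilon>) powr (A * real k)"
    using assms by (simp add: powr_realpow[symmetric] powr_powr)
  also have "A * real k = d_VC n n0 j"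
    by (simp add: A_def d_VC_def k_def L_def u_def c_def mult_ac)
  finally show ?thesis by (simp only: k_def)
qed

text \<open>The factor independent of \<open>N\<close>, made up of the choice of a support and of
  \<open>1 / t ^ (n0 + 1)\<close>, is what \<open>d_VC\<close> has to absorb.\<close>

lemma traces_tail_bound:
  fixes \<epsilon> p :: real
  assumes "n0 \<le> n" "1 \<le> j" "0 < \<epsilon>" "\<epsilon> < 1" "0 \<le> p"
    and p: "(1 + \<epsilon>) ^ N * p \<le> real ((n choose n0) * (\<Sum>i\<le>n0 + 1. (2 * N * j) choose i))"
  shows "p \<le> exp (- (real N * \<epsilon> / 4)) * (12 / \<epsilon>) powr d_VC n n0 j"
proof -
  \<comment> \<open>This \<open>t\<close> makes \<open>(1 + t)^(2 N j) \<le> exp (N \<epsilon> / 4)\<close>, half of the gain from \<open>(1 + \<epsilon>)^N \<ge> exp (N \<epsilon> / 2)\<close>.\<close>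
  define t where "t = \<epsilon> / (8 * real j)"
  have t: "0 < t" "t \<le> 1" using assms by (auto simp: t_def field_simps)
  have "exp (real N * \<epsilon> / 2) * p = exp (\<epsilon> / 2) ^ N * p"
    by (simp add: exp_of_nat_mult[symmetric])
  also have "\<dots> \<le> (1 + \<epsilon>) ^ N * p"
    using assms by (intro mult_right_mono power_mono exp_half_le_one_plus) auto
  also have "\<dots> \<le> real (n choose n0) * (\<Sum>i\<le>n0 + 1. real ((2 * N * j) choose i))"
    using p by (simp only: of_nat_mult of_nat_sum)
  also have "\<dots> \<le> real (n choose n0) * ((1 + t) ^ (2 * N * j) / t ^ (n0 + 1))"
    by (intro mult_left_mono sum_choose_le t) auto
  also have "\<dots> \<le> real (n choose n0) * (exp t ^ (2 * N * j) / t ^ (n0 + 1))"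
    using t by (intro mult_left_mono divide_right_mono power_mono) (auto simp: exp_ge_add_one_self)
  also have "exp t ^ (2 * N * j) = exp (real N * \<epsilon> / 4)"
    using assms by (simp add: exp_of_nat_mult[symmetric] t_def)
  also have "real (n choose n0) * (exp (real N * \<epsilon> / 4) / t ^ (n0 + 1))
      = exp (real N * \<epsilon> / 4) * (real (n choose n0) * (8 * real j / \<epsilon>) ^ (n0 + 1))"
    by (simp add: t_def power_divide)
  also have "\<dots> \<le> exp (real N * \<epsilon> / 4) * (12 / \<epsilon>) powr d_VC n n0 j"
    by (intro mult_left_mono d_VC_power_bound assms) auto
  finally have "p \<le> exp (real N * \<epsilon> / 4) * (12 / \<epsilon>) powr d_VC n n0 j / exp (real N * \<epsilon> / 2)"
    by (simp add: field_simps)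
  also have "\<dots> = exp (real N * \<epsilon> / 4 - real N * \<epsilon> / 2) * (12 / \<epsilon>) powr d_VC n n0 j"
    by (simp only: exp_diff times_divide_eq_left)
  also have "real N * \<epsilon> / 4 - real N * \<epsilon> / 2 = - (real N * \<epsilon> / 4)" by simp
  finally show ?thesis .
qed

section \<open>Two-stage problems\<close>

lemma recourse_eq_infty_iff:
  assumes "\<forall>y. \<bar>g \<zeta> y\<bar> \<noteq> \<infinity>"
  shows "recourse g W T h \<zeta> x = \<infinity> \<longleftrightarrow> (\<nexists>y. W \<zeta> *v y = h \<zeta> - T \<zeta> *v x \<and> 0 \<le> y)"
proof
  assume inf: "recourse g W T h \<zeta> x = \<infinity>"
  show "\<nexists>y. W \<zeta> *v y = h \<zeta> - T \<zeta> *v x \<and> 0 \<le> y"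
  proof
    assume "\<exists>y. W \<zeta> *v y = h \<zeta> - T \<zeta> *v x \<and> 0 \<le> y"
    then obtain y where "W \<zeta> *v y + T \<zeta> *v x = h \<zeta>" "0 \<le> y"
      by (auto simp: eq_diff_eq)
    then have "recourse g W T h \<zeta> x \<le> g \<zeta> y"
      unfolding recourse_def by (intro Inf_lower) auto
    with inf spec[OF assms, of y] show False by auto
  qed
next
  assume "\<nexists>y. W \<zeta> *v y = h \<zeta> - T \<zeta> *v x \<and> 0 \<le> y"
  then have "{g \<zeta> y | y. W \<zeta> *v y + T \<zeta> *v x = h \<zeta> \<and> 0 \<le> y} = {}"
    by (auto simp: eq_diff_eq)
  then show "recourse g W T h \<zeta> x = \<infinity>"
    unfolding recourse_def by (simp only:) (simp add: top_ereal_def)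
qed

text \<open>Infeasibility means a negative product of \<open>h \<zeta> - T \<zeta> *v x\<close> with
  some ray representative, and each such product is affine in \<open>x\<close>.\<close>

lemma recourse_infty_halfspaces:
  fixes W :: "real ^ 'r \<Rightarrow> real ^ 'p ^ 'm" and T :: "real ^ 'r \<Rightarrow> real ^ 'n ^ 'm"
  assumes "\<forall>y. \<bar>g \<zeta> y\<bar> \<noteq> \<infinity>" "rows_independent (W \<zeta>)"
    and "finite (extreme_rays (dual_cone (W \<zeta>)))" "card (extreme_rays (dual_cone (W \<zeta>))) \<le> k"
  shows "\<exists>(\<alpha> :: nat \<Rightarrow> real) (\<beta> :: nat \<Rightarrow> real ^ 'n). \<forall>x.
    recourse g W T h \<zeta> x = \<infinity> \<longleftrightarrow> (\<exists>l<k. \<alpha> l + \<beta> l \<bullet> x < 0)"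
proof -
  obtain e :: "nat \<Rightarrow> real ^ 'm" where
    e: "\<And>b. (\<exists>y. W \<zeta> *v y = b \<and> 0 \<le> y) \<longleftrightarrow> (\<forall>l<k. 0 \<le> e l \<bullet> b)"
    using infeasible_iff_extreme_rays[OF assms(2-4)] by auto
  have "e l \<bullet> (h \<zeta> - T \<zeta> *v x) = e l \<bullet> h \<zeta> + (- (e l v* T \<zeta>)) \<bullet> x" for l x
    by (simp add: inner_diff_right dot_lmul_matrix)
  then show ?thesis
    unfolding recourse_eq_infty_iff[where g = g and \<zeta> = \<zeta>, OF assms(1)] e
    by (intro exI[of _ "\<lambda>l. e l \<bullet> h \<zeta>"] exI[of _ "\<lambda>l. - (e l v* T \<zeta>)"]) (auto simp: not_le)
qed

lemma card_recourse_traces_le: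
  fixes W :: "real ^ 'r \<Rightarrow> real ^ 'p ^ 'm" and T :: "real ^ 'r \<Rightarrow> real ^ 'n ^ 'm"
    and \<zeta> :: "'i \<Rightarrow> real ^ 'r"
  assumes "finite I" "n0 \<le> CARD('n)" "X \<subseteq> {x. l0norm x \<le> n0}"
    and rays: "\<And>\<eta>. \<eta> \<in> \<Xi> \<Longrightarrow> rows_independent (W \<eta>) \<and>
      finite (extreme_rays (dual_cone (W \<eta>))) \<and> card (extreme_rays (dual_cone (W \<eta>))) \<le> k"
  shows "card ((\<lambda>x. {i\<in>I. \<zeta> i \<in> \<Xi> \<and> (\<forall>y. \<bar>g (\<zeta> i) y\<bar> \<noteq> \<infinity>) \<and> recourse g W T h (\<zeta> i) x = \<infinity>}) ` X)
    \<le> (CARD('n) choose n0) * (\<Sum>i\<le>n0 + 1. (card I * k) choose i)"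
proof -
  have "\<exists>(\<alpha> :: nat \<Rightarrow> real) (\<beta> :: nat \<Rightarrow> real ^ 'n). \<forall>x.
      (\<zeta> i \<in> \<Xi> \<and> (\<forall>y. \<bar>g (\<zeta> i) y\<bar> \<noteq> \<infinity>) \<and> recourse g W T h (\<zeta> i) x = \<infinity>)
        \<longleftrightarrow> (\<exists>l<k. \<alpha> l + \<beta> l \<bullet> x < 0)" for i
  proof (cases "\<zeta> i \<in> \<Xi> \<and> (\<forall>y. \<bar>g (\<zeta> i) y\<bar> \<noteq> \<infinity>)")
    case True
    then show ?thesis using recourse_infty_halfspaces[of g "\<zeta> i" W k T h] rays by simp
  next
    case False
    \<comment> \<open>With zero coefficients the condition reads \<open>0 < 0\<close>, so an
      excluded scenario never counts as violated.\<close>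
    then show ?thesis by (intro exI[of _ "\<lambda>_. 0"]) auto
  qed
  then obtain \<alpha> :: "'i \<Rightarrow> nat \<Rightarrow> real" and \<beta> :: "'i \<Rightarrow> nat \<Rightarrow> real ^ 'n" where
    "\<And>i x. (\<zeta> i \<in> \<Xi> \<and> (\<forall>y. \<bar>g (\<zeta> i) y\<bar> \<noteq> \<infinity>) \<and> recourse g W T h (\<zeta> i) x = \<infinity>)
        \<longleftrightarrow> (\<exists>l<k. \<alpha> i l + \<beta> i l \<bullet> x < 0)"
    by metis
  then show ?thesis
    using card_union_halfspace_traces_le[OF assms(1-3), of k \<alpha> \<beta>] by simp
qed

theorem corollary4p10:
  fixes M :: "'a measure"
    and \<xi> :: "'a \<Rightarrow> real ^ 'r"
    and \<Xi> :: "(real ^ 'r) set"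
    and X :: "(real ^ 'n) set"
    and f0 :: "real ^ 'n \<Rightarrow> real"
    and g :: "real ^ 'r \<Rightarrow> real ^ 'p \<Rightarrow> ereal"
    and W :: "real ^ 'r \<Rightarrow> real ^ 'p ^ 'm"
    and T :: "real ^ 'r \<Rightarrow> real ^ 'n ^ 'm"
    and h :: "real ^ 'r \<Rightarrow> real ^ 'm"
    and n0 N :: nat
    and xstar :: "(nat \<Rightarrow> real ^ 'r) \<Rightarrow> real ^ 'n"
  defines "f \<equiv> recourse g W T h"
    and "P \<equiv> law M \<Xi> \<xi>"
    and "d \<equiv> d_VC CARD('n) n0 (card_J W \<Xi>)"
  assumes "prob_space M" and "complete_measure M"
    and "\<xi> \<in> M \<rightarrow>\<^sub>M restrict_space borel \<Xi>"
    and "X \<noteq> {}" and "closed X"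
    and "AE \<zeta> in P. (\<forall>y. \<bar>g \<zeta> y\<bar> \<noteq> \<infinity>) \<and> convex_on UNIV (\<lambda>y. real_of_ereal (g \<zeta> y))"
    and "\<forall>\<zeta>\<in>\<Xi>. rows_independent (W \<zeta>)"
    and "\<forall>\<zeta>\<in>\<Xi>. \<forall>x\<in>X. f \<zeta> x \<noteq> - \<infinity>"
    and "\<forall>\<zeta>\<in>\<Xi>. lsc_on X (f \<zeta>)"
    and "jointly_measurable M X (\<lambda>\<omega> x. f (\<xi> \<omega>) x)"
    and "\<exists>x\<in>X. objective M \<xi> f0 f x < \<infinity>"
    and "n0 \<le> CARD('n)" and "X \<subseteq> {x. l0norm x \<le> n0}"
    and "finite_J W \<Xi>"
    and "0 < N"
    and "\<forall>s\<in>space (sample_law N P). saa_feasible N X f s \<noteq> {} \<longrightarrow> xstar s \<in> saa_feasible N X f s"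
    (* measurability of the quantities of interest *)
    and "\<forall>x\<in>X. {\<zeta> \<in> \<Xi>. f \<zeta> x = \<infinity>} \<in> sets P"
    and "xstar \<in> borel_measurable (sample_law N P)"
    and "(\<lambda>s. violation P f (xstar s)) \<in> borel_measurable (sample_law N P)"
  shows "(\<forall>\<delta> \<epsilon>. 0 < \<delta> \<and> \<delta> < 1 \<and> 0 < \<epsilon> \<and> \<epsilon> < 1 \<and>
            real N \<ge> 4 / \<epsilon> * (d * ln (12 / \<epsilon>) + ln (2 / \<delta>)) \<longrightarrow>
            measure (sample_law N P)
              {s \<in> space (sample_law N P). violation P f (xstar s) > \<epsilon>} \<le> \<delta>) \<and>
         (\<forall>\<epsilon>. 0 < \<epsilon> \<and> \<epsilon> < 1 \<longrightarrow>
            measure (sample_law N P)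
              {s \<in> space (sample_law N P). violation P f (xstar s) > \<epsilon>}
              \<le> 2 * exp (- (real N * \<epsilon> / 4)) * (12 / \<epsilon>) powr d)"
proof -
  have sp: "space P = \<Xi>"
    unfolding P_def by (rule space_law) fact+
  define J where "J = card_J W \<Xi>"
  have rays: "rows_independent (W \<zeta>) \<and> finite (extreme_rays (dual_cone (W \<zeta>))) \<and>
      card (extreme_rays (dual_cone (W \<zeta>))) \<le> J" if "\<zeta> \<in> \<Xi>" for \<zeta>
    using that \<open>finite_J W \<Xi>\<close> \<open>\<forall>\<zeta>\<in>\<Xi>. rows_independent (W \<zeta>)\<close>
    unfolding finite_J_def J_def card_J_def by (auto intro!: Max_ge)
  have fin: "AE \<zeta> in P. \<forall>y. \<bar>g \<zeta> y\<bar> \<noteq> \<infinity>"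
    using \<open>AE \<zeta> in P. (\<forall>y. \<bar>g \<zeta> y\<bar> \<noteq> \<infinity>) \<and> _ \<zeta>\<close> by eventually_elim auto
  define prb where "prb \<epsilon> = measure (sample_law N P)
    {s \<in> space (sample_law N P). violation P f (xstar s) > \<epsilon>}" for \<epsilon>
  have rate: "prb \<epsilon> \<le> exp (- (real N * \<epsilon> / 4)) * (12 / \<epsilon>) powr d" if \<epsilon>: "0 < \<epsilon>" "\<epsilon> < 1" for \<epsilon>
  proof (cases "J = 0")
    case True
    \<comment> \<open>The numerical bound requires \<open>1 \<le> j\<close>. Without extreme rays
      there is no half-space to violate, so the second stage is almost surely feasible.\<close>
    have "violation P f x = 0" for x
    proof -
      have "AE \<zeta> in P. f \<zeta> x \<noteq> \<infinity>"
        using fin AE_space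
      proof eventually_elim
        case (elim \<zeta>)
        then have "\<zeta> \<in> \<Xi>" using sp by simp
        with rays[OF this] elim(1) True show ?case
          using recourse_infty_halfspaces[of g \<zeta> W 0 T h] by (simp add: f_def)
      qed
      \<comment> \<open>Here \<open>x\<close> is arbitrary, so the set may fail to be measurable;
        its \<open>measure\<close> is then 0 by convention.\<close>
      then show ?thesis
        unfolding violation_def by (cases "{\<zeta> \<in> space P. f \<zeta> x = \<infinity>} \<in> sets P")
          (auto simp: AE_iff_measurable[OF _ refl] measure_notin_sets measure_def emeasure_notin_sets)
    qed
    then have "prb \<epsilon> = 0" using \<epsilon> by (simp add: prb_def)
    then show ?thesis by simp
  next
    case False
    obtain x0 where x0: "x0 \<in> X" "objective M \<xi> f0 f x0 < \<infinity>"
      using \<open>\<exists>x\<in>X. objective M \<xi> f0 f x < \<infinity>\<close> by auto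
    have viol: "\<And>x. x \<in> X \<Longrightarrow> {\<zeta> \<in> \<Xi>. f \<zeta> x = \<infinity>} \<in> sets P"
      using \<open>\<forall>x\<in>X. {\<zeta> \<in> \<Xi>. f \<zeta> x = \<infinity>} \<in> sets P\<close> by blast
    have "{\<omega> \<in> space M. f (\<xi> \<omega>) x0 = \<infinity>} \<in> sets M"
      by (rule violation_eq_prob(2)[where f = f and x = x0]) (use viol[OF x0(1)] assms(5,6) in \<open>auto simp: P_def\<close>)
    then have AE0: "AE \<omega> in M. f (\<xi> \<omega>) x0 < \<infinity>"
      using x0(2) by (rule objective_finite_AE)
    have "(1 + \<epsilon>) ^ N * prb \<epsilon>
        \<le> real ((CARD('n) choose n0) * (\<Sum>i\<le>n0 + 1. (2 * N * J) choose i))"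
      unfolding prb_def
    proof (rule violation_tail_bound[where M = M and \<Xi> = \<Xi> and \<xi> = \<xi> and X = X and ?x0.0 = x0 and f = f
          and good = "\<lambda>\<zeta>. \<forall>y. \<bar>g \<zeta> y\<bar> \<noteq> \<infinity>", folded P_def])
      show "card ((\<lambda>x. {i \<in> {..<2 * N}. \<xi> (z i) \<in> \<Xi> \<and> (\<forall>y. \<bar>g (\<xi> (z i)) y\<bar> \<noteq> \<infinity>) \<and> f (\<xi> (z i)) x = \<infinity>}) ` X)
          \<le> (CARD('n) choose n0) * (\<Sum>i\<le>n0 + 1. (2 * N * J) choose i)" for z
        using card_recourse_traces_le[of "{..<2 * N}" n0 X \<Xi> W J "\<lambda>i. \<xi> (z i)" g T h] rays
          \<open>n0 \<le> CARD('n)\<close> \<open>X \<subseteq> {x. l0norm x \<le> n0}\<close> by (simp add: f_def)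
    qed (use assms(4-6) \<open>closed X\<close> x0 AE0 fin \<open>jointly_measurable M X _\<close> viol assms(19) assms(21,22) \<epsilon> in auto)
    then show ?thesis
      unfolding d_def J_def[symmetric] using False \<epsilon> \<open>n0 \<le> CARD('n)\<close>
      by (intro traces_tail_bound) (auto simp: prb_def)
  qed
  have rate2: "prb \<epsilon> \<le> 2 * exp (- (real N * \<epsilon> / 4)) * (12 / \<epsilon>) powr d" if \<epsilon>: "0 < \<epsilon>" "\<epsilon> < 1" for \<epsilon>
    using rate[OF \<epsilon>] by (rule order_trans) simp
  have "prb \<epsilon> \<le> \<delta>" if \<epsilon>: "0 < \<delta>" "0 < \<epsilon>" "\<epsilon> < 1"
    and N: "real N \<ge> 4 / \<epsilon> * (d * ln (12 / \<epsilon>) + ln (2 / \<delta>))" for \<delta> \<epsilon>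
  proof -
    \<comment> \<open>The threshold on \<open>N\<close> is where the rate bound, with its factor 2,
      equals \<delta>.\<close>
    have "d * ln (12 / \<epsilon>) + ln (2 / \<delta>) \<le> real N * \<epsilon> / 4"
      using N \<epsilon> by (simp add: field_simps)
    then have "exp (- (real N * \<epsilon> / 4)) \<le> exp (- (d * ln (12 / \<epsilon>) + ln (2 / \<delta>)))" by simp
    also have "\<dots> = inverse ((12 / \<epsilon>) powr d * (2 / \<delta>))"
      using \<epsilon> by (simp only: exp_minus exp_add) (simp add: powr_def)
    finally have "2 * exp (- (real N * \<epsilon> / 4)) * (12 / \<epsilon>) powr d
        \<le> 2 * inverse ((12 / \<epsilon>) powr d * (2 / \<delta>)) * (12 / \<epsilon>) powr d"
      by (intro mult_right_mono mult_left_mono) auto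
    also have "\<dots> = \<delta>" using \<epsilon> by (simp add: field_simps)
    finally show ?thesis using rate2[OF \<epsilon>(2,3)] by linarith
  qed
  with rate2 show ?thesis unfolding prb_def by blast
qed

end
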